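(* Let $n\ge 3$ and let $p_1,p_2,\dots,p_n$ be integers, all $\ge 2$. Let $G_{p_1\dots p_n}=\langle a_1,\dots,a_n;\ a_1^{p_1}a_2^{p_2}\cdots a_n^{p_n}=1\rangle$. Then $\mathrm{Dim}(R(G_{p_1\dots p_n}))=3(n-1)$.
   Context: For a finitely generated group $G$ with generators $x_1,\dots,x_n$, $R(G)=\mathrm{Hom}(G,SL_2\mathbb{C})$ is the representation variety of $G$: the complex affine algebraic set of all $n$-tuples in $(SL_2\mathbb{C})^n$ satisfying the relations of $G$. Up to isomorphism of algebraic varieties it does not depend on the chosen finite generating set. $\mathrm{Dim}$ denotes the (Krull) dimension. *)

theory Defs
  imports
    "HOL-Analysis.Analysis"
    "HOL-Algebra.Group"
begin

section \<open>Affine algebraic sets and Krull dimension\<close>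

text \<open>Affine space over a set \<open>I\<close> of coordinates is \<^term>\<open>PiE I (\<lambda>_. UNIV :: complex set)\<close>.  Since the
  complex numbers are infinite, polynomials may be identified with polynomial functions.\<close>

inductive complex_poly_fun :: "'i set \<Rightarrow> (('i \<Rightarrow> complex) \<Rightarrow> complex) \<Rightarrow> bool" for I where
  const: "complex_poly_fun I (\<lambda>_. c)"
| coord: "i \<in> I \<Longrightarrow> complex_poly_fun I (\<lambda>x. x i)"
| add: "complex_poly_fun I f \<Longrightarrow> complex_poly_fun I g \<Longrightarrow> complex_poly_fun I (\<lambda>x. f x + g x)"
| mult: "complex_poly_fun I f \<Longrightarrow> complex_poly_fun I g \<Longrightarrow> complex_poly_fun I (\<lambda>x. f x * g x)"

definition zero_locus :: "'i set \<Rightarrow> (('i \<Rightarrow> complex) \<Rightarrow> complex) set \<Rightarrow> ('i \<Rightarrow> complex) set" where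
  "zero_locus I F = {x \<in> PiE I (\<lambda>_. UNIV). \<forall>f\<in>F. f x = 0}"

definition zariski :: "'i set \<Rightarrow> ('i \<Rightarrow> complex) topology" where
  "zariski I = topology (\<lambda>U. \<exists>F \<subseteq> Collect (complex_poly_fun I).
     U = PiE I (\<lambda>_. UNIV) - zero_locus I F)"

lemma istopology_zariski:
  "istopology (\<lambda>U. \<exists>F \<subseteq> Collect (complex_poly_fun I). U = PiE I (\<lambda>_. UNIV) - zero_locus I F)"
  (is "istopology ?L")
  unfolding istopology_def
proof (intro conjI allI impI)
  fix S T assume "?L S" "?L T"
  then obtain F G where F: "F \<subseteq> Collect (complex_poly_fun I)" "S = PiE I (\<lambda>_. UNIV) - zero_locus I F"
    and G: "G \<subseteq> Collect (complex_poly_fun I)" "T = PiE I (\<lambda>_. UNIV) - zero_locus I G"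
    by auto
  let ?H = "{\<lambda>x. f x * g x | f g. f \<in> F \<and> g \<in> G}"
  have "?H \<subseteq> Collect (complex_poly_fun I)"
    using F(1) G(1) by (auto intro: complex_poly_fun.mult)
  moreover have "S \<inter> T = PiE I (\<lambda>_. UNIV) - zero_locus I ?H"
    unfolding F(2) G(2) zero_locus_def by fastforce
  ultimately show "?L (S \<inter> T)" by blast
next
  fix K assume K: "\<forall>S\<in>K. ?L S"
  let ?H = "\<Union>{F. F \<subseteq> Collect (complex_poly_fun I) \<and> PiE I (\<lambda>_. UNIV) - zero_locus I F \<in> K}"
  have "\<Union>K = PiE I (\<lambda>_. UNIV) - zero_locus I ?H"
  proof (rule Set.set_eqI)
    fix x
    have "x \<in> \<Union>K \<longleftrightarrow> (\<exists>F \<subseteq> Collect (complex_poly_fun I).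
        PiE I (\<lambda>_. UNIV) - zero_locus I F \<in> K \<and> x \<in> PiE I (\<lambda>_. UNIV) - zero_locus I F)"
      using K by (metis UnionE UnionI)
    then show "x \<in> \<Union>K \<longleftrightarrow> x \<in> PiE I (\<lambda>_. UNIV) - zero_locus I ?H"
      unfolding zero_locus_def by auto
  qed
  moreover have "?H \<subseteq> Collect (complex_poly_fun I)" by blast
  ultimately show "?L (\<Union>K)" by blast
qed

lemma closedin_zariski:
  "closedin (zariski I) Z \<longleftrightarrow> (\<exists>F \<subseteq> Collect (complex_poly_fun I). Z = zero_locus I F)"
proof -
  have op: "openin (zariski I) U \<longleftrightarrow> (\<exists>F \<subseteq> Collect (complex_poly_fun I).
      U = PiE I (\<lambda>_. UNIV) - zero_locus I F)" for U
    by (simp add: zariski_def topology_inverse'[OF istopology_zariski])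
  have "PiE I (\<lambda>_. UNIV) = PiE I (\<lambda>_. UNIV) - zero_locus I {\<lambda>_. 1}"
    by (auto simp: zero_locus_def)
  then have "openin (zariski I) (PiE I (\<lambda>_. UNIV))"
    unfolding op by (intro exI[of _ "{\<lambda>_. 1}"]) (auto intro: complex_poly_fun.const)
  moreover have "U \<subseteq> PiE I (\<lambda>_. UNIV)" if "openin (zariski I) U" for U
    using that unfolding op by auto
  ultimately have top: "topspace (zariski I) = PiE I (\<lambda>_. UNIV)"
    by (metis openin_subset openin_topspace subset_antisym)
  have "zero_locus I F \<subseteq> PiE I (\<lambda>_. UNIV)" for F
    by (auto simp: zero_locus_def)
  then show ?thesis
    unfolding closedin_def op top by (metis double_diff order_refl)
qed

definition irreducible_space :: "'a topology \<Rightarrow> bool" where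
  "irreducible_space X \<longleftrightarrow> topspace X \<noteq> {} \<and>
     (\<forall>A B. closedin X A \<and> closedin X B \<and> A \<union> B = topspace X \<longrightarrow> A = topspace X \<or> B = topspace X)"

text \<open>The supremum of the lengths \<open>m\<close> of chains \<open>Z 0 \<subset> \<dots> \<subset> Z m\<close> of irreducible closed subsets
  (with value \<open>0\<close> for the empty space).\<close>

definition krull_dim :: "'a topology \<Rightarrow> enat" where
  "krull_dim X = Sup {enat m | m. \<exists>Z :: nat \<Rightarrow> 'a set.
     (\<forall>i\<le>m. closedin X (Z i) \<and> irreducible_space (subtopology X (Z i))) \<and>
     (\<forall>i<m. Z i \<subset> Z (Suc i))}"

definition affine_dim_of :: "'i set \<Rightarrow> ('i \<Rightarrow> complex) set \<Rightarrow> enat" where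
  "affine_dim_of I V = krull_dim (subtopology (zariski I) V)"

section \<open>Groups given by generators and relators\<close>

text \<open>A letter \<open>(x, False)\<close> is the generator \<open>x\<close>, and \<open>(x, True)\<close> is its inverse.\<close>

type_synonym 'x word = "('x \<times> bool) list"

inductive_set pres_cong :: "'x set \<Rightarrow> 'x word set \<Rightarrow> ('x word \<times> 'x word) set"
  for X R where
  refl: "u \<in> lists (X \<times> UNIV) \<Longrightarrow> (u, u) \<in> pres_cong X R"
| sym: "(u, v) \<in> pres_cong X R \<Longrightarrow> (v, u) \<in> pres_cong X R"
| trans: "(u, v) \<in> pres_cong X R \<Longrightarrow> (v, w) \<in> pres_cong X R \<Longrightarrow> (u, w) \<in> pres_cong X R"
| append: "(u, u') \<in> pres_cong X R \<Longrightarrow> (v, v') \<in> pres_cong X R \<Longrightarrow> (u @ v, u' @ v') \<in> pres_cong X R"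
| cancel: "x \<in> X \<Longrightarrow> ([(x, b), (x, \<not> b)], []) \<in> pres_cong X R"
| relator: "r \<in> R \<Longrightarrow> r \<in> lists (X \<times> UNIV) \<Longrightarrow> (r, []) \<in> pres_cong X R"

definition presented_group :: "'x set \<Rightarrow> 'x word set \<Rightarrow> 'x word set monoid" where
  "presented_group X R =
     \<lparr>carrier = lists (X \<times> UNIV) // pres_cong X R,
      monoid.mult = (\<lambda>A B. \<Union>u\<in>A. \<Union>v\<in>B. pres_cong X R `` {u @ v}),
      one = pres_cong X R `` {[]}\<rparr>"

definition pres_gen :: "'x set \<Rightarrow> 'x word set \<Rightarrow> 'x \<Rightarrow> 'x word set" where
  "pres_gen X R x = pres_cong X R `` {[(x, False)]}"

section \<open>Representation varieties\<close>

definition SL2C :: "(complex^2^2) monoid" where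
  "SL2C = \<lparr>carrier = {A. det A = 1}, monoid.mult = (**), one = mat 1\<rparr>"

text \<open>For a group \<open>G\<close> generated by the elements \<open>x i\<close>, \<open>i \<in> I\<close>, a homomorphism \<open>\<rho>\<close> is recorded as
  the point of affine space whose coordinate \<open>(i, j, k)\<close> is the \<open>(j, k)\<close> entry of \<open>\<rho> (x i)\<close>.\<close>

definition rep_variety ::
    "('g, 'b) monoid_scheme \<Rightarrow> 'i set \<Rightarrow> ('i \<Rightarrow> 'g) \<Rightarrow> (('i \<times> 2 \<times> 2) \<Rightarrow> complex) set" where
  "rep_variety G I x =
     (\<lambda>\<rho>. \<lambda>(i, j, k) \<in> I \<times> UNIV \<times> UNIV. \<rho> (x i) $ j $ k) ` hom G SL2C"

definition rep_variety_dim ::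
    "('g, 'b) monoid_scheme \<Rightarrow> 'i set \<Rightarrow> ('i \<Rightarrow> 'g) \<Rightarrow> enat" where
  "rep_variety_dim G I x = affine_dim_of (I \<times> UNIV \<times> UNIV) (rep_variety G I x)"

text \<open>The word \<open>a\<^sub>1^(p 1) a\<^sub>2^(p 2) \<dots> a\<^sub>n^(p n)\<close>.\<close>

definition power_word :: "nat \<Rightarrow> (nat \<Rightarrow> nat) \<Rightarrow> nat word" where
  "power_word n p = concat (map (\<lambda>i. replicate (p i) (i, False)) [1..<Suc n])"

end

theory Submission
  imports Defs "HOL-Complex_Analysis.Conformal_Mappings"
begin

text \<open>
  By the universal property of a presentation, the representation variety is the set \<open>V\<close> of all
  tuples \<open>(A\<^sub>1, \<dots>, A\<^sub>n)\<close> of matrices of determinant \<open>1\<close> with \<open>A\<^sub>1^(p 1) \<dots> A\<^sub>n^(p n) = 1\<close>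
  (\<open>rep_variety_power_word\<close>).  Choosing all matrices but one should leave finitely many choices for
  the remaining one, whence the dimension \<open>3 (n - 1)\<close>; the exceptions are the tuples in which the
  missing power is a scalar matrix, since \<open>\<plusminus>1\<close> has infinitely many roots.  Everything about roots rests
  on the Cayley--Hamilton theorem in the form \<open>A^p = U\<^sub>p(t) A - U\<^sub>p\<^sub>-\<^sub>1(t)\<close> with \<open>t = tr A\<close>, where
  \<open>U\<^sub>p\<close> is a Chebyshev polynomial, and on \<open>tr (A^p) = T\<^sub>p(t)\<close> with \<open>T\<^sub>p\<close> monic of degree \<open>p\<close>.

  Upper bound.  Along a chain of irreducible closed subsets, each strict inclusion allows one more
  algebraically independent polynomial function: a function that vanishes on the smaller set but not
  on the larger one (\<open>alg_indep_on_extend\<close>).  So it suffices that any \<open>3 (n - 1) + 1\<close> polynomial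
  functions on \<open>V\<close> are algebraically dependent, and by counting monomials this follows if the
  polynomials of degree at most \<open>N\<close> span on \<open>V\<close> a space of dimension \<open>O(N^(3 (n - 1)))\<close>
  (\<open>growth_at_most_dependent\<close>).  Growth of this kind is insensitive to finite unions, to integral
  elements and to denominators without zeros, and goes up by at most one with each new generator.  Cover
  \<open>V\<close> by \<open>n + 1\<close> pieces.  Where all \<open>A\<^sub>i^(p i)\<close> are \<open>\<plusminus>1\<close>, the traces satisfy \<open>T\<^sub>p(t)\<^sup>2 = 4\<close>, and
  only the \<open>2 n\<close> off-diagonal entries remain free, where \<open>2 n \<le> 3 (n - 1)\<close> because of \<open>n \<ge> 3\<close>.  Where
  \<open>A\<^sub>i^(p i)\<close> is not \<open>\<plusminus>1\<close>, the other \<open>n - 1\<close> matrices have \<open>3\<close> parameters each, the trace of \<open>A\<^sub>i\<close>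
  is integral over them, and the entries of \<open>A\<^sub>i\<close> are regular after division by \<open>U\<^sub>p(t)\<close>, which has no
  zero there.

  Lower bound.  Write \<open>A\<^sub>1, \<dots>, A\<^sub>n\<^sub>-\<^sub>1\<close> as products of three elementary matrices, with \<open>3 (n - 1)\<close>
  free parameters, and let \<open>A\<^sub>n\<close> be the inverse of a holomorphic \<open>p n\<close>-th root of the product of
  the other powers; such a root exists as long as the trace of this product has real part above
  \<open>2\<close>, in particular on a small polydisc.  The identity theorem, applied on complex lines, shows that
  the Zariski closure of the image of each coordinate slice of the polydisc is irreducible.  The
  slices of dimensions \<open>0, \<dots>, 3 (n - 1)\<close> give the chain; the inclusions are strict because
  each parameter can be read off from the entries of the matrices (\<open>parameter_separation\<close>).
\<close>

section \<open>Growth of algebras of functions\<close>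

text \<open>The degree filtration of the algebra of functions generated by \<open>F\<close>.  The degree is an upper bound
  only: constants belong to every step.\<close>

inductive poly_in :: "('a \<Rightarrow> complex) set \<Rightarrow> nat \<Rightarrow> ('a \<Rightarrow> complex) \<Rightarrow> bool" for F where
  const: "poly_in F N (\<lambda>_. c)"
| gen: "g \<in> F \<Longrightarrow> poly_in F (Suc N) g"
| add: "poly_in F N f \<Longrightarrow> poly_in F N g \<Longrightarrow> poly_in F N (\<lambda>x. f x + g x)"
| mult: "poly_in F M f \<Longrightarrow> poly_in F N g \<Longrightarrow> poly_in F (M + N) (\<lambda>x. f x * g x)"

lemma poly_in_mono:
  assumes "poly_in F M f" "M \<le> N"
  shows "poly_in F N f"
  using poly_in.mult[OF assms(1) poly_in.const[of F "N - M" 1]] assms(2) by simp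

lemma poly_in_sum:
  "(\<And>a. a \<in> A \<Longrightarrow> poly_in F N (f a)) \<Longrightarrow> poly_in F N (\<lambda>x. \<Sum>a\<in>A. f a x)"
  by (induction A rule: infinite_finite_induct) (auto intro: poly_in.intros)

lemma poly_in_prod:
  "(\<And>a. a \<in> A \<Longrightarrow> poly_in F N (f a)) \<Longrightarrow> poly_in F (N * card A) (\<lambda>x. \<Prod>a\<in>A. f a x)"
proof (induction A rule: infinite_finite_induct)
  case (insert a A)
  then have "poly_in F (N + N * card A) (\<lambda>x. f a x * (\<Prod>a\<in>A. f a x))"
    by (intro poly_in.mult) auto
  with insert show ?case by simp
qed (auto intro: poly_in.intros)

lemma poly_in_power: "poly_in F N f \<Longrightarrow> poly_in F (N * k) (\<lambda>x. f x ^ k)"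
  using poly_in_prod[of "{..<k}" F N "\<lambda>_. f"] by simp

lemma poly_in_scale: "poly_in F N f \<Longrightarrow> poly_in F N (\<lambda>x. c * f x)"
  using poly_in.mult[OF poly_in.const[of F 0 c]] by fastforce

lemma poly_in_subset: "poly_in F N f \<Longrightarrow> F \<subseteq> G \<Longrightarrow> poly_in G N f"
  by (induction rule: poly_in.induct) (auto intro: poly_in.intros)

text \<open>The coefficients \<open>h k\<close> beyond the degree are required to vanish so that the product of two
  expansions is the product of two univariate polynomials.\<close>

lemma poly_in_insert_expand:
  assumes "poly_in (insert g F) N f"
  shows "\<exists>h. (\<forall>k. poly_in F N (h k)) \<and> (\<forall>k>N. h k = (\<lambda>_. 0)) \<and>
    (\<forall>x. f x = (\<Sum>k\<le>N. h k x * g x ^ k))"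
  using assms
proof induction
  case (const N c)
  show ?case
    by (rule exI[of _ "\<lambda>k x. if k = 0 then c else 0"])
      (auto intro: poly_in.const simp: if_distrib if_distribR sum.delta cong: if_cong)
next
  case (gen g' N)
  show ?case
  proof (cases "g' = g")
    case True
    then show ?thesis
      by (intro exI[of _ "\<lambda>k x. if k = 1 then 1 else 0"])
        (auto intro: poly_in.const simp: if_distrib if_distribR sum.delta cong: if_cong)
  next
    case False
    with gen have "g' \<in> F" by simp
    then have "poly_in F (Suc N) (\<lambda>x. if k = 0 then g' x else 0)" for k
      by (cases "k = 0") (auto intro: poly_in.intros)
    then show ?thesis
      by (intro exI[of _ "\<lambda>k x. if k = 0 then g' x else 0"])
        (auto simp: if_distrib if_distribR sum.delta cong: if_cong)
  qed
next
  case (add N f1 f2)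
  then obtain h1 h2 where h: "\<forall>k. poly_in F N (h1 k)" "\<forall>k>N. h1 k = (\<lambda>_. 0)"
    "\<forall>x. f1 x = (\<Sum>k\<le>N. h1 k x * g x ^ k)"
    "\<forall>k. poly_in F N (h2 k)" "\<forall>k>N. h2 k = (\<lambda>_. 0)"
    "\<forall>x. f2 x = (\<Sum>k\<le>N. h2 k x * g x ^ k)"
    by blast
  then show ?case
    by (intro exI[of _ "\<lambda>k x. h1 k x + h2 k x"])
      (auto intro: poly_in.add simp: sum.distrib ring_distribs)
next
  case (mult M f1 N f2)
  then obtain h1 h2 where h: "\<forall>k. poly_in F M (h1 k)" "\<forall>k>M. h1 k = (\<lambda>_. 0)"
    "\<forall>x. f1 x = (\<Sum>k\<le>M. h1 k x * g x ^ k)"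
    "\<forall>k. poly_in F N (h2 k)" "\<forall>k>N. h2 k = (\<lambda>_. 0)"
    "\<forall>x. f2 x = (\<Sum>k\<le>N. h2 k x * g x ^ k)"
    by blast
  let ?h = "\<lambda>k x. \<Sum>i\<le>k. h1 i x * h2 (k - i) x"
  have "poly_in F (M + N) (?h k)" for k
    by (intro poly_in_sum poly_in.mult) (auto simp: h)
  moreover have "?h k x = 0" if "k > M + N" for k x
  proof (rule sum.neutral, safe)
    fix i
    have "i > M \<or> k - i > N" using that by linarith
    then show "h1 i x * h2 (k - i) x = 0" using h(2,5) by auto
  qed
  moreover have "f1 x * f2 x = (\<Sum>k\<le>M+N. ?h k x * g x ^ k)" for x
    using polynomial_product[of M "\<lambda>i. h1 i x" N "\<lambda>i. h2 i x" "g x"] h by simp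
  ultimately show ?case by (intro exI[of _ ?h]) auto
qed

text \<open>Working with spanning sets and with equality on \<open>S\<close> alone avoids the vector space of functions on
  \<open>S\<close>.\<close>

definition spanned_on :: "'a set \<Rightarrow> ('a \<Rightarrow> complex) set \<Rightarrow> ('a \<Rightarrow> complex) \<Rightarrow> bool" where
  "spanned_on S W f \<longleftrightarrow> (\<exists>c. \<forall>x\<in>S. f x = (\<Sum>w\<in>W. c w * w x))"

lemma spanned_on_cong: "(\<And>x. x \<in> S \<Longrightarrow> f x = g x) \<Longrightarrow> spanned_on S W f \<longleftrightarrow> spanned_on S W g"
  unfolding spanned_on_def by simp

lemma spanned_on_base:
  assumes "finite W" "w \<in> W" shows "spanned_on S W w"
  unfolding spanned_on_def
  by (rule exI[of _ "\<lambda>v. if v = w then 1 else 0"])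
    (use assms in \<open>auto simp: if_distrib if_distribR sum.delta cong: if_cong\<close>)

lemma spanned_on_scale: "spanned_on S W f \<Longrightarrow> spanned_on S W (\<lambda>x. c * f x)"
  unfolding spanned_on_def
  by (elim exE, rule_tac x = "\<lambda>w. c * ca w" in exI) (simp add: sum_distrib_left mult.assoc)

lemma spanned_on_zero: "spanned_on S W (\<lambda>_. 0)"
  unfolding spanned_on_def by (rule exI[of _ "\<lambda>_. 0"]) simp

lemma spanned_on_add:
  "spanned_on S W f \<Longrightarrow> spanned_on S W g \<Longrightarrow> spanned_on S W (\<lambda>x. f x + g x)"
  unfolding spanned_on_def
  by (elim exE, rule_tac x = "\<lambda>w. c w + ca w" in exI) (simp add: sum.distrib ring_distribs)

lemma spanned_on_sum:
  "(\<And>a. a \<in> A \<Longrightarrow> spanned_on S W (f a)) \<Longrightarrow> spanned_on S W (\<lambda>x. \<Sum>a\<in>A. f a x)"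
  by (induction A rule: infinite_finite_induct) (auto intro: spanned_on_zero spanned_on_add)

lemma spanned_on_trans:
  assumes "spanned_on S V f" "\<And>v. v \<in> V \<Longrightarrow> spanned_on S W (\<lambda>x. h x * v x)"
  shows "spanned_on S W (\<lambda>x. h x * f x)"
proof -
  obtain c where c: "\<forall>x\<in>S. f x = (\<Sum>v\<in>V. c v * v x)" using assms(1) unfolding spanned_on_def by blast
  have "spanned_on S W (\<lambda>x. \<Sum>v\<in>V. c v * (h x * v x))"
    by (intro spanned_on_sum spanned_on_scale assms(2))
  then show ?thesis
    by (rule iffD1[OF spanned_on_cong, rotated]) (simp add: c sum_distrib_left mult.left_commute)
qed

text \<open>A polynomial growth bound of degree \<open>D\<close>, as in the definition of the Gelfand--Kirillov dimension.  The
  base \<open>N + 1\<close> makes it meaningful for \<open>N = 0\<close>.\<close>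

definition growth_at_most :: "'a set \<Rightarrow> ('a \<Rightarrow> complex) set \<Rightarrow> nat \<Rightarrow> bool" where
  "growth_at_most S F D \<longleftrightarrow> (\<exists>C. \<forall>N. \<exists>W. finite W \<and> card W \<le> C * (N + 1) ^ D \<and>
     (\<forall>f. poly_in F N f \<longrightarrow> spanned_on S W f))"

lemma growth_at_most_empty: "growth_at_most S {} 0"
proof -
  have "\<exists>c. f = (\<lambda>_. c)" if "poly_in {} N f" for N and f :: "'a \<Rightarrow> complex"
    using that by induction auto
  moreover have "spanned_on S {\<lambda>_. 1} (\<lambda>_. c)" for c
    unfolding spanned_on_def by auto
  ultimately show ?thesis unfolding growth_at_most_def
    by (intro exI[of _ 1] allI exI[of _ "{\<lambda>_. 1}"]) fastforce
qed

lemma growth_at_most_mono: "growth_at_most S F D \<Longrightarrow> D \<le> E \<Longrightarrow> growth_at_most S F E"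
proof -
  assume D: "growth_at_most S F D" "D \<le> E"
  then obtain C where C: "\<forall>N. \<exists>W. finite W \<and> card W \<le> C * (N + 1) ^ D \<and>
     (\<forall>f. poly_in F N f \<longrightarrow> spanned_on S W f)" unfolding growth_at_most_def by blast
  have "C * (N + 1) ^ D \<le> C * (N + 1) ^ E" for N
    using D(2) by (intro mult_left_mono power_increasing) auto
  then show ?thesis unfolding growth_at_most_def using C by (meson le_trans)
qed

text \<open>The powers \<open>g ^ 0, \<dots>, g ^ N\<close> are all that \<open>g\<close> contributes in degree \<open>N\<close>, which accounts for one more
  factor \<open>N + 1\<close>.\<close>

lemma growth_at_most_insert:
  assumes "growth_at_most S F D" shows "growth_at_most S (insert g F) (Suc D)"
proof -
  obtain C where C: "\<And>N. \<exists>W. finite W \<and> card W \<le> C * (N + 1) ^ D \<and>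
     (\<forall>f. poly_in F N f \<longrightarrow> spanned_on S W f)" using assms unfolding growth_at_most_def by blast
  have "\<exists>W. finite W \<and> card W \<le> C * (N + 1) ^ Suc D \<and>
     (\<forall>f. poly_in (insert g F) N f \<longrightarrow> spanned_on S W f)" for N
  proof -
    obtain W where W: "finite W" "card W \<le> C * (N + 1) ^ D"
      "\<And>f. poly_in F N f \<Longrightarrow> spanned_on S W f" using C by blast
    let ?W = "(\<lambda>(k, w) x. g x ^ k * w x) ` ({..N} \<times> W)"
    have fin: "finite ?W" using W(1) by simp
    have "card ?W \<le> card ({..N} \<times> W)" using W(1) by (intro card_image_le) simp
    also have "\<dots> = (N + 1) * card W" by (simp add: card_cartesian_product)
    also have "\<dots> \<le> (N + 1) * (C * (N + 1) ^ D)" using W(2) by (rule mult_left_mono) simp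
    finally have card: "card ?W \<le> C * (N + 1) ^ Suc D" by (simp add: algebra_simps)
    have "spanned_on S ?W f" if f: "poly_in (insert g F) N f" for f
    proof -
      obtain h where h: "\<forall>k. poly_in F N (h k)" "\<forall>x. f x = (\<Sum>k\<le>N. h k x * g x ^ k)"
        using poly_in_insert_expand[OF f] by blast
      have "spanned_on S ?W (\<lambda>x. g x ^ k * h k x)" if "k \<le> N" for k
        by (rule spanned_on_trans[OF W(3)[OF h(1)[rule_format]]], rule spanned_on_base[OF fin])
          (use that in auto)
      then have "spanned_on S ?W (\<lambda>x. \<Sum>k\<le>N. g x ^ k * h k x)"
        by (intro spanned_on_sum) simp
      then show ?thesis
        by (rule iffD1[OF spanned_on_cong, rotated]) (simp add: h(2) mult.commute)
    qed
    with fin card show ?thesis by blast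
  qed
  then show ?thesis unfolding growth_at_most_def by blast
qed

lemma growth_at_most_card: "finite F \<Longrightarrow> growth_at_most S F (card F)"
proof (induction F rule: finite_induct)
  case (insert g F)
  with growth_at_most_insert[of S F "card F" g] show ?case by simp
qed (simp add: growth_at_most_empty)

text \<open>Equality is demanded on \<open>S\<close> only, so that equations which hold on \<open>S\<close> can be used to show that a
  function is regular.\<close>

definition regular_on :: "'a set \<Rightarrow> ('a \<Rightarrow> complex) set \<Rightarrow> ('a \<Rightarrow> complex) \<Rightarrow> bool" where
  "regular_on S F f \<longleftrightarrow> (\<exists>N h. poly_in F N h \<and> (\<forall>x\<in>S. f x = h x))"

lemma regular_on_const [intro]: "regular_on S F (\<lambda>_. c)"
  unfolding regular_on_def using poly_in.const by blast

lemma regular_on_gen: "g \<in> F \<Longrightarrow> regular_on S F g"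
  unfolding regular_on_def using poly_in.gen by blast

lemma regular_on_cong: "regular_on S F f \<Longrightarrow> (\<And>x. x \<in> S \<Longrightarrow> g x = f x) \<Longrightarrow> regular_on S F g"
  unfolding regular_on_def by force

lemma regular_on_subset: "regular_on S F f \<Longrightarrow> F \<subseteq> G \<Longrightarrow> regular_on S G f"
  unfolding regular_on_def using poly_in_subset by blast

lemma regular_on_add [intro]:
  assumes "regular_on S F f" "regular_on S F g" shows "regular_on S F (\<lambda>x. f x + g x)"
proof -
  obtain M N f' g' where "poly_in F M f'" "poly_in F N g'" "\<forall>x\<in>S. f x = f' x" "\<forall>x\<in>S. g x = g' x"
    using assms unfolding regular_on_def by blast
  then show ?thesis unfolding regular_on_def
    by (intro exI[of _ "M + N"] exI[of _ "\<lambda>x. f' x + g' x"])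
      (auto intro!: poly_in.add elim: poly_in_mono)
qed

lemma regular_on_mult [intro]:
  assumes "regular_on S F f" "regular_on S F g" shows "regular_on S F (\<lambda>x. f x * g x)"
proof -
  obtain M N f' g' where "poly_in F M f'" "poly_in F N g'" "\<forall>x\<in>S. f x = f' x" "\<forall>x\<in>S. g x = g' x"
    using assms unfolding regular_on_def by blast
  then show ?thesis unfolding regular_on_def
    by (intro exI[of _ "M + N"] exI[of _ "\<lambda>x. f' x * g' x"])
      (auto intro: poly_in.mult)
qed

lemma regular_on_uminus [intro]: "regular_on S F f \<Longrightarrow> regular_on S F (\<lambda>x. - f x)"
  using regular_on_mult[OF regular_on_const[of S F "-1"]] by simp

lemma regular_on_diff [intro]:
  "regular_on S F f \<Longrightarrow> regular_on S F g \<Longrightarrow> regular_on S F (\<lambda>x. f x - g x)"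
  using regular_on_add[OF _ regular_on_uminus] by fastforce

lemma regular_on_power [intro]: "regular_on S F f \<Longrightarrow> regular_on S F (\<lambda>x. f x ^ k)"
  by (induction k) (auto intro: regular_on_const)

lemma regular_on_poly: "regular_on S F f \<Longrightarrow> regular_on S F (\<lambda>x. poly q (f x))"
  by (induction q) auto

text \<open>For finite families, membership in an algebra is thus turned into estimates of degrees.\<close>

lemma regular_on_uniform:
  assumes "finite G" "\<And>g. g \<in> G \<Longrightarrow> regular_on S F g"
  shows "\<exists>e. \<forall>g\<in>G. \<exists>h. poly_in F e h \<and> (\<forall>x\<in>S. g x = h x)"
  using assms
proof (induction G rule: finite_induct)
  case (insert g G)
  then obtain e where e: "\<forall>g\<in>G. \<exists>h. poly_in F e h \<and> (\<forall>x\<in>S. g x = h x)" by blast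
  obtain N h where "poly_in F N h" "\<forall>x\<in>S. g x = h x"
    using insert.prems[of g] unfolding regular_on_def by blast
  then have "\<forall>g'\<in>insert g G. \<exists>h. poly_in F (e + N) h \<and> (\<forall>x\<in>S. g' x = h x)"
    using e by (metis insert_iff le_add1 le_add2 poly_in_mono)
  then show ?case by blast
qed simp

text \<open>Division with remainder by a monic polynomial.  What matters is that the degree of the coefficients
  grows only linearly in the exponent \<open>k\<close>.\<close>

lemma power_reduction:
  assumes "poly_in F e u" "q \<noteq> 0" "lead_coeff q = 1" "\<And>x. x \<in> S \<Longrightarrow> poly q (g x) = u x"
    "degree q > 0"
  shows "\<exists>r. (\<forall>i. poly_in F (e * k) (r i)) \<and> (\<forall>x\<in>S. g x ^ k = (\<Sum>i<degree q. r i x * g x ^ i))"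
proof (induction k)
  case 0
  show ?case
    by (rule exI[of _ "\<lambda>i x. if i = 0 then 1 else 0"])
      (use assms(5) in \<open>auto intro: poly_in.const simp: if_distrib if_distribR sum.delta cong: if_cong\<close>)
next
  case (Suc k)
  let ?d = "degree q"
  obtain r where r: "\<forall>i. poly_in F (e * k) (r i)"
    "\<forall>x\<in>S. g x ^ k = (\<Sum>i<?d. r i x * g x ^ i)" using Suc by blast
  define c where "c = (\<lambda>i x. (if i = 0 then u x else 0) + (- coeff q i) * 1)"
  have c: "poly_in F e (c i)" for i
    unfolding c_def
    by (intro poly_in.add) (cases "i = 0", auto intro: poly_in.const assms(1))
  \<comment> \<open>The equation of \<open>g\<close> itself, with the value \<open>u\<close> absorbed into the constant coefficient.\<close>
  have top: "g x ^ ?d = (\<Sum>i<?d. c i x * g x ^ i)" if "x \<in> S" for x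
  proof -
    have "u x = (\<Sum>i<?d. coeff q i * g x ^ i) + g x ^ ?d"
      using assms(3) unfolding assms(4)[OF that, symmetric]
      by (simp add: poly_altdef lessThan_Suc_atMost[symmetric])
    moreover have "(\<Sum>i<?d. c i x * g x ^ i) = u x - (\<Sum>i<?d. coeff q i * g x ^ i)"
    proof -
      have "c i x * g x ^ i = (if i = 0 then u x else 0) - coeff q i * g x ^ i" for i
        by (simp add: c_def algebra_simps)
      then show ?thesis
        using assms(5) by (simp add: sum_subtractf sum.delta)
    qed
    ultimately show ?thesis by simp
  qed
  define r' where "r' = (\<lambda>i x. (if i = 0 then 0 else r (i - 1) x) + r (?d - 1) x * c i x)"
  have "poly_in F (e * Suc k) (r' i)" for i
  proof -
    have "poly_in F (e * k + e) (\<lambda>x. r (?d - 1) x * c i x)" using r c by (intro poly_in.mult) auto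
    moreover have "poly_in F (e * k + e) (\<lambda>x. if i = 0 then 0 else r (i - 1) x)"
      using r by (cases "i = 0") (auto intro: poly_in.const poly_in_mono)
    ultimately show ?thesis unfolding r'_def
      using poly_in.add by (fastforce simp: algebra_simps)
  qed
  moreover have "g x ^ Suc k = (\<Sum>i<?d. r' i x * g x ^ i)" if "x \<in> S" for x
  proof -
    obtain d where d: "?d = Suc d" using assms(5) gr0_implies_Suc by blast
    have "g x ^ Suc k = (\<Sum>i<?d. r i x * g x ^ Suc i)"
      using r(2) that by (simp add: sum_distrib_left mult_ac)
    also have "\<dots> = (\<Sum>i<d. r i x * g x ^ Suc i) + r d x * g x ^ ?d" by (simp add: d)
    also have "\<dots> = (\<Sum>i<?d. (if i = 0 then 0 else r (i - 1) x) * g x ^ i) + r d x * g x ^ ?d"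
      unfolding d sum.lessThan_Suc_shift by simp
    also have "\<dots> = (\<Sum>i<?d. r' i x * g x ^ i)"
    proof -
      have "?d - 1 = d" using d by simp
      then have "(\<Sum>i<?d. r' i x * g x ^ i) = (\<Sum>i<?d. (if i = 0 then 0 else r (i - 1) x) * g x ^ i) +
          r d x * (\<Sum>i<?d. c i x * g x ^ i)"
        unfolding r'_def by (simp only: sum.distrib ring_distribs sum_distrib_left mult.assoc)
      then show ?thesis unfolding top[OF that] by simp
    qed
    finally show ?thesis .
  qed
  ultimately show ?case by blast
qed

text \<open>An integral element contributes only the boundedly many powers \<open>g ^ i\<close> with \<open>i < degree q\<close>, at the cost of a
  constant factor in the degree of the coefficients; neither affects the exponent \<open>D\<close>.\<close>

lemma growth_at_most_integral:
  assumes "growth_at_most S F D" "regular_on S F (\<lambda>x. poly q (g x))"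
    "lead_coeff q = 1" "degree q > 0"
  shows "growth_at_most S (insert g F) D"
proof -
  obtain C where C: "\<And>N. \<exists>W. finite W \<and> card W \<le> C * (N + 1) ^ D \<and>
     (\<forall>f. poly_in F N f \<longrightarrow> spanned_on S W f)" using assms(1) unfolding growth_at_most_def by blast
  obtain e u where u: "poly_in F e u" "\<forall>x\<in>S. poly q (g x) = u x"
    using assms(2) unfolding regular_on_def by blast
  have "\<exists>r. (\<forall>i. poly_in F (e * k) (r i)) \<and> (\<forall>x\<in>S. g x ^ k = (\<Sum>i<degree q. r i x * g x ^ i))" for k
    using power_reduction[of F e u q S g k] u assms(3,4) by force
  then obtain r where r: "\<And>k i. poly_in F (e * k) (r k i)"
    "\<And>k x. x \<in> S \<Longrightarrow> g x ^ k = (\<Sum>i<degree q. r k i x * g x ^ i)" by metis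
  have "\<exists>W. finite W \<and> card W \<le> (degree q * C * (e + 1) ^ D) * (N + 1) ^ D \<and>
     (\<forall>f. poly_in (insert g F) N f \<longrightarrow> spanned_on S W f)" for N
  proof -
    obtain W where W: "finite W" "card W \<le> C * ((e + 1) * N + 1) ^ D"
      "\<And>f. poly_in F ((e + 1) * N) f \<Longrightarrow> spanned_on S W f" using C by blast
    let ?W = "(\<lambda>(k, w) x. g x ^ k * w x) ` ({..<degree q} \<times> W)"
    have fin: "finite ?W" using W(1) by simp
    have "card ?W \<le> card ({..<degree q} \<times> W)" using W(1) by (intro card_image_le) simp
    also have "\<dots> = degree q * card W" by (simp add: card_cartesian_product)
    also have "\<dots> \<le> degree q * (C * ((e + 1) * (N + 1)) ^ D)"
      using W(2) by (intro mult_left_mono order.trans[OF W(2)] power_mono) auto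
    finally have card: "card ?W \<le> (degree q * C * (e + 1) ^ D) * (N + 1) ^ D"
      by (simp only: power_mult_distrib mult.assoc)
    have "spanned_on S ?W f" if f: "poly_in (insert g F) N f" for f
    proof -
      obtain h where h: "\<forall>k. poly_in F N (h k)" "\<forall>x. f x = (\<Sum>k\<le>N. h k x * g x ^ k)"
        using poly_in_insert_expand[OF f] by blast
      let ?s = "\<lambda>i x. \<Sum>k\<le>N. h k x * r k i x"
      have s: "poly_in F ((e + 1) * N) (?s i)" for i
      proof (intro poly_in_sum)
        fix k assume "k \<in> {..N}"
        then have "N + e * k \<le> (e + 1) * N" by simp
        then show "poly_in F ((e + 1) * N) (\<lambda>x. h k x * r k i x)"
          using poly_in.mult[of F N "h k" "e * k" "r k i"] h(1) r(1) poly_in_mono by blast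
      qed
      have "spanned_on S ?W (\<lambda>x. g x ^ i * ?s i x)" if "i < degree q" for i
        by (rule spanned_on_trans[OF W(3)[OF s]], rule spanned_on_base[OF fin]) (use that in auto)
      then have "spanned_on S ?W (\<lambda>x. \<Sum>i<degree q. g x ^ i * ?s i x)"
        by (intro spanned_on_sum) simp
      moreover have "(\<Sum>i<degree q. g x ^ i * ?s i x) = f x" if "x \<in> S" for x
      proof -
        have "f x = (\<Sum>k\<le>N. h k x * (\<Sum>i<degree q. r k i x * g x ^ i))"
          unfolding h(2)[rule_format, of x] r(2)[OF that, symmetric] ..
        also have "\<dots> = (\<Sum>k\<le>N. \<Sum>i<degree q. g x ^ i * (h k x * r k i x))"
          by (simp add: sum_distrib_left mult_ac)
        also have "\<dots> = (\<Sum>i<degree q. g x ^ i * ?s i x)"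
          by (subst sum.swap) (simp add: sum_distrib_left)
        finally show ?thesis by simp
      qed
      ultimately show ?thesis by (rule iffD1[OF spanned_on_cong, rotated])
    qed
    with fin card show ?thesis by blast
  qed
  then show ?thesis unfolding growth_at_most_def by blast
qed

lemma growth_at_most_union_integral:
  assumes "finite G" "growth_at_most S F D"
    "\<And>g. g \<in> G \<Longrightarrow> \<exists>q. regular_on S F (\<lambda>x. poly q (g x)) \<and> lead_coeff q = 1 \<and> degree q > 0"
  shows "growth_at_most S (F \<union> G) D"
  using assms
proof (induction G rule: finite_induct)
  case (insert g G)
  then obtain q where q: "regular_on S F (\<lambda>x. poly q (g x))" "lead_coeff q = 1" "degree q > 0"
    by blast
  have "growth_at_most S (insert g (F \<union> G)) D"
    by (rule growth_at_most_integral[OF insert.IH regular_on_subset[OF q(1)] q(2,3)])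
      (use insert.prems in auto)
  then show ?case by simp
qed simp

text \<open>Multiplication by \<open>w ^ N\<close> turns functions of degree \<open>N\<close> in \<open>F'\<close> into functions of degree \<open>O(N)\<close> in
  \<open>F\<close>, and it is injective because \<open>w\<close> has no zero on \<open>S\<close>.  So adjoining the inverse of \<open>w\<close> does not
  increase the growth.\<close>

lemma growth_at_most_localise:
  assumes "growth_at_most S F D" "finite F'" "regular_on S F w"
    and nz: "\<And>x. x \<in> S \<Longrightarrow> w x \<noteq> 0"
    and num: "\<And>f. f \<in> F' \<Longrightarrow> regular_on S F (\<lambda>x. w x * f x)"
  shows "growth_at_most S F' D"
proof -
  obtain C where C: "\<And>N. \<exists>W. finite W \<and> card W \<le> C * (N + 1) ^ D \<and>
     (\<forall>f. poly_in F N f \<longrightarrow> spanned_on S W f)" using assms(1) unfolding growth_at_most_def by blast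
  have "\<exists>e. \<forall>g\<in>insert w ((\<lambda>f x. w x * f x) ` F'). \<exists>h. poly_in F e h \<and> (\<forall>x\<in>S. g x = h x)"
    by (rule regular_on_uniform) (use assms in auto)
  then obtain e v where v: "poly_in F e v" "\<forall>x\<in>S. w x = v x"
    and e: "\<And>f. f \<in> F' \<Longrightarrow> \<exists>h. poly_in F e h \<and> (\<forall>x\<in>S. w x * f x = h x)" by auto
  have clear: "\<exists>h. poly_in F (e * N) h \<and> (\<forall>x\<in>S. w x ^ N * f x = h x)" if "poly_in F' N f" for N f
    using that
  proof induction
    case (const N c)
    show ?case using poly_in_scale[OF poly_in_power[OF v(1), of N], of c] v(2)
      by (auto simp: mult.commute)
  next
    case (gen f N)
    then obtain h where h: "poly_in F e h" "\<forall>x\<in>S. w x * f x = h x" using e by blast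
    have "poly_in F (e * N + e) (\<lambda>x. v x ^ N * h x)"
      by (intro poly_in.mult poly_in_power v h)
    then show ?case using v(2) h(2)
      by (intro exI[of _ "\<lambda>x. v x ^ N * h x"]) (auto simp: algebra_simps)
  next
    case (add N f g)
    then obtain f' g' where "poly_in F (e * N) f'" "\<forall>x\<in>S. w x ^ N * f x = f' x"
      "poly_in F (e * N) g'" "\<forall>x\<in>S. w x ^ N * g x = g' x" by blast
    then show ?case
      by (intro exI[of _ "\<lambda>x. f' x + g' x"]) (auto intro: poly_in.add simp: ring_distribs)
  next
    case (mult M f N g)
    then obtain f' g' where fg: "poly_in F (e * M) f'" "\<forall>x\<in>S. w x ^ M * f x = f' x"
      "poly_in F (e * N) g'" "\<forall>x\<in>S. w x ^ N * g x = g' x" by blast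
    have "poly_in F (e * (M + N)) (\<lambda>x. f' x * g' x)"
      using poly_in.mult[OF fg(1,3)] by (simp add: ring_distribs)
    moreover have "w x ^ (M + N) * (f x * g x) = f' x * g' x" if "x \<in> S" for x
      using fg(2,4)[rule_format, OF that, symmetric] by (simp add: power_add mult_ac)
    ultimately show ?case by blast
  qed
  have "\<exists>W. finite W \<and> card W \<le> (C * (e + 1) ^ D) * (N + 1) ^ D \<and>
     (\<forall>f. poly_in F' N f \<longrightarrow> spanned_on S W f)" for N
  proof -
    obtain W where W: "finite W" "card W \<le> C * (e * N + 1) ^ D"
      "\<And>f. poly_in F (e * N) f \<Longrightarrow> spanned_on S W f" using C by blast
    let ?W = "(\<lambda>v x. inverse (w x ^ N) * v x) ` W"
    have fin: "finite ?W" using W(1) by simp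
    have "card ?W \<le> card W" by (intro card_image_le W)
    also have "\<dots> \<le> C * ((e + 1) * (N + 1)) ^ D"
      by (intro mult_left_mono order.trans[OF W(2)] power_mono) auto
    finally have card: "card ?W \<le> (C * (e + 1) ^ D) * (N + 1) ^ D"
      by (simp only: power_mult_distrib mult.assoc)
    have "spanned_on S ?W f" if f: "poly_in F' N f" for f
    proof -
      obtain h where h: "poly_in F (e * N) h" "\<forall>x\<in>S. w x ^ N * f x = h x"
        using clear[OF f] by blast
      have "spanned_on S ?W (\<lambda>x. inverse (w x ^ N) * h x)"
        by (rule spanned_on_trans[OF W(3)[OF h(1)]], rule spanned_on_base[OF fin]) auto
      then show ?thesis
        by (rule iffD1[OF spanned_on_cong, rotated]) (use h(2) nz in \<open>simp flip: h(2)\<close>)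
    qed
    with fin card show ?thesis by blast
  qed
  then show ?thesis unfolding growth_at_most_def by blast
qed

text \<open>Spanning functions of the two pieces are extended by zero; their numbers add up.\<close>

lemma growth_at_most_Un:
  assumes "growth_at_most S F D" "growth_at_most T F D"
  shows "growth_at_most (S \<union> T) F D"
proof -
  obtain C1 C2 where C: "\<And>N. \<exists>W. finite W \<and> card W \<le> C1 * (N + 1) ^ D \<and>
     (\<forall>f. poly_in F N f \<longrightarrow> spanned_on S W f)"
    "\<And>N. \<exists>W. finite W \<and> card W \<le> C2 * (N + 1) ^ D \<and>
     (\<forall>f. poly_in F N f \<longrightarrow> spanned_on T W f)" using assms unfolding growth_at_most_def by metis
  have "\<exists>W. finite W \<and> card W \<le> (C1 + C2) * (N + 1) ^ D \<and>
     (\<forall>f. poly_in F N f \<longrightarrow> spanned_on (S \<union> T) W f)" for N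
  proof -
    obtain V W where V: "finite V" "card V \<le> C1 * (N + 1) ^ D"
      "\<And>f. poly_in F N f \<Longrightarrow> spanned_on S V f"
      and W: "finite W" "card W \<le> C2 * (N + 1) ^ D"
      "\<And>f. poly_in F N f \<Longrightarrow> spanned_on T W f" using C by meson
    let ?V = "(\<lambda>v x. of_bool (x \<in> S) * v x) ` V" and ?W = "(\<lambda>v x. of_bool (x \<notin> S) * v x) ` W"
    have "card (?V \<union> ?W) \<le> card V + card W"
      by (rule order.trans[OF card_Un_le]) (intro add_mono card_image_le V W)
    then have card: "card (?V \<union> ?W) \<le> (C1 + C2) * (N + 1) ^ D"
      using V(2) W(2) by (simp only: ring_distribs)
    have fin: "finite (?V \<union> ?W)" using V W by simp
    have "spanned_on (S \<union> T) (?V \<union> ?W) f" if f: "poly_in F N f" for f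
    proof -
      obtain c d where cd: "\<And>x. x \<in> S \<Longrightarrow> f x = (\<Sum>v\<in>V. c v * v x)"
        "\<And>x. x \<in> T \<Longrightarrow> f x = (\<Sum>v\<in>W. d v * v x)"
        using V(3)[OF f] W(3)[OF f] unfolding spanned_on_def by blast
      have "spanned_on (S \<union> T) (?V \<union> ?W) (\<lambda>x. (\<Sum>v\<in>V. c v * (of_bool (x \<in> S) * v x)) +
          (\<Sum>v\<in>W. d v * (of_bool (x \<notin> S) * v x)))"
        by (intro spanned_on_add spanned_on_sum spanned_on_scale spanned_on_base fin) auto
      then show ?thesis
        by (rule iffD1[OF spanned_on_cong, rotated]) (auto simp: cd)
    qed
    with fin card show ?thesis by blast
  qed
  then show ?thesis unfolding growth_at_most_def by blast
qed

lemma growth_at_most_UN: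
  assumes "finite A" "A \<noteq> {}" "\<And>a. a \<in> A \<Longrightarrow> growth_at_most (S a) F D"
  shows "growth_at_most (\<Union>a\<in>A. S a) F D"
  using assms by (induction A rule: finite_ne_induct) (auto intro: growth_at_most_Un)

lemma growth_at_most_anti:
  assumes "growth_at_most T F D" "S \<subseteq> T"
  shows "growth_at_most S F D"
proof -
  have "spanned_on T W f \<Longrightarrow> spanned_on S W f" for W f
    using assms(2) unfolding spanned_on_def by blast
  then show ?thesis using assms(1) unfolding growth_at_most_def by meson
qed

section \<open>Algebraic independence and Krull dimension\<close>

text \<open>A homogeneous linear system with more unknowns than equations, by Gaussian elimination.\<close>

lemma homogeneous_system:
  fixes c :: "'j \<Rightarrow> 'w \<Rightarrow> complex"
  assumes "finite W" "finite J" "card W < card J"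
  shows "\<exists>d. (\<exists>j\<in>J. d j \<noteq> 0) \<and> (\<forall>w\<in>W. (\<Sum>j\<in>J. d j * c j w) = 0)"
  using assms
proof (induction W arbitrary: c J rule: finite_induct)
  case empty
  then obtain j where "j \<in> J" by fastforce
  then show ?case by (intro exI[of _ "\<lambda>_. 1"]) auto
next
  case (insert w W)
  show ?case
  proof (cases "\<forall>j\<in>J. c j w = 0")
    case True
    obtain d where "\<exists>j\<in>J. d j \<noteq> 0" "\<forall>w\<in>W. (\<Sum>j\<in>J. d j * c j w) = 0"
      using insert.IH[of J c] insert.prems insert.hyps by auto
    with True show ?thesis by (intro exI[of _ d]) (auto intro!: sum.neutral)
  next
    case False
    then obtain j0 where j0: "j0 \<in> J" "c j0 w \<noteq> 0" by blast
    let ?J = "J - {j0}"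
    define r where "r = (\<lambda>j. c j w / c j0 w)"
    have "card W < card ?J" using insert.prems insert.hyps j0(1) by simp
    then obtain d where d: "\<exists>j\<in>?J. d j \<noteq> 0"
      "\<forall>v\<in>W. (\<Sum>j\<in>?J. d j * (c j v - r j * c j0 v)) = 0"
      using insert.IH[of ?J "\<lambda>j v. c j v - r j * c j0 v"] insert.prems by auto
    \<comment> \<open>The value at \<open>j0\<close> is forced by the equation that belongs to \<open>w\<close>.\<close>
    define d' where "d' = d(j0 := - (\<Sum>j\<in>?J. d j * r j))"
    have split: "(\<Sum>j\<in>J. d' j * c j v) = (\<Sum>j\<in>?J. d j * (c j v - r j * c j0 v))" for v
    proof -
      have "(\<Sum>j\<in>J. d' j * c j v) = d' j0 * c j0 v + (\<Sum>j\<in>?J. d' j * c j v)"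
        using insert.prems(1) j0(1) by (simp add: sum.remove)
      also have "(\<Sum>j\<in>?J. d' j * c j v) = (\<Sum>j\<in>?J. d j * c j v)"
        by (intro sum.cong) (auto simp: d'_def)
      finally show ?thesis
        by (simp add: d'_def sum_subtractf right_diff_distrib sum_distrib_right mult.assoc)
    qed
    have "(\<Sum>j\<in>J. d' j * c j w) = 0"
      unfolding split by (rule sum.neutral) (use j0(2) in \<open>simp add: r_def\<close>)
    moreover have "\<exists>j\<in>J. d' j \<noteq> 0" using d(1) by (auto simp: d'_def)
    ultimately show ?thesis using d(2) split by (intro exI[of _ d']) auto
  qed
qed

lemma spanned_on_dependent:
  assumes "finite W" "finite J" "card W < card J" "\<And>j. j \<in> J \<Longrightarrow> spanned_on S W (f j)"
  shows "\<exists>d. (\<exists>j\<in>J. d j \<noteq> 0) \<and> (\<forall>x\<in>S. (\<Sum>j\<in>J. d j * f j x) = 0)"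
proof -
  obtain c where c: "\<And>j x. j \<in> J \<Longrightarrow> x \<in> S \<Longrightarrow> f j x = (\<Sum>w\<in>W. c j w * w x)"
    using assms(4) unfolding spanned_on_def by metis
  obtain d where d: "\<exists>j\<in>J. d j \<noteq> 0" "\<forall>w\<in>W. (\<Sum>j\<in>J. d j * c j w) = 0"
    using homogeneous_system[OF assms(1-3)] by blast
  have "(\<Sum>j\<in>J. d j * f j x) = 0" if "x \<in> S" for x
  proof -
    have "(\<Sum>j\<in>J. d j * f j x) = (\<Sum>j\<in>J. \<Sum>w\<in>W. d j * c j w * w x)"
      using c that by (simp add: sum_distrib_left mult.assoc)
    also have "\<dots> = (\<Sum>w\<in>W. (\<Sum>j\<in>J. d j * c j w) * w x)"
      by (subst sum.swap) (simp add: sum_distrib_right)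
    finally show ?thesis using d(2) by simp
  qed
  with d(1) show ?thesis by blast
qed

lemma complex_poly_fun_sum:
  "(\<And>a. a \<in> A \<Longrightarrow> complex_poly_fun I (f a)) \<Longrightarrow> complex_poly_fun I (\<lambda>x. \<Sum>a\<in>A. f a x)"
  by (induction A rule: infinite_finite_induct) (auto intro: complex_poly_fun.intros)

lemma complex_poly_fun_prod:
  "(\<And>a. a \<in> A \<Longrightarrow> complex_poly_fun I (f a)) \<Longrightarrow> complex_poly_fun I (\<lambda>x. \<Prod>a\<in>A. f a x)"
  by (induction A rule: infinite_finite_induct) (auto intro: complex_poly_fun.intros)

lemma complex_poly_fun_power: "complex_poly_fun I f \<Longrightarrow> complex_poly_fun I (\<lambda>x. f x ^ k)"
  using complex_poly_fun_prod[of "{..<k}" I "\<lambda>_. f"] by simp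

lemma complex_poly_fun_cong:
  "complex_poly_fun I f \<Longrightarrow> (\<And>i. i \<in> I \<Longrightarrow> x i = y i) \<Longrightarrow> f x = f y"
  by (induction rule: complex_poly_fun.induct) auto

lemma complex_poly_fun_mono: "complex_poly_fun I f \<Longrightarrow> I \<subseteq> J \<Longrightarrow> complex_poly_fun J f"
  by (induction rule: complex_poly_fun.induct) (auto intro: complex_poly_fun.intros)

lemma complex_poly_fun_compose:
  "complex_poly_fun I f \<Longrightarrow> (\<And>i. i \<in> I \<Longrightarrow> complex_poly_fun J (g i)) \<Longrightarrow>
    complex_poly_fun J (\<lambda>x. f (\<lambda>i. g i x))"
  by (induction rule: complex_poly_fun.induct) (auto intro: complex_poly_fun.intros)

lemma complex_poly_fun_minus:
  assumes "complex_poly_fun I f" "complex_poly_fun I g" shows "complex_poly_fun I (\<lambda>x. f x - g x)"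
  using complex_poly_fun.add[OF assms(1)
      complex_poly_fun.mult[OF complex_poly_fun.const[of I "-1"] assms(2)]] by simp

lemma complex_poly_fun_iff_poly_in:
  "complex_poly_fun I f \<longleftrightarrow> (\<exists>N. poly_in ((\<lambda>i x. x i) ` I) N f)"
proof
  assume "complex_poly_fun I f"
  then show "\<exists>N. poly_in ((\<lambda>i x. x i) ` I) N f"
  proof induction
    case (add f g)
    then obtain M N where "poly_in ((\<lambda>i x. x i) ` I) M f" "poly_in ((\<lambda>i x. x i) ` I) N g" by blast
    then have "poly_in ((\<lambda>i x. x i) ` I) (M + N) (\<lambda>x. f x + g x)"
      by (intro poly_in.add) (auto elim: poly_in_mono)
    then show ?case by blast
  qed (blast intro: poly_in.intros)+
next
  assume "\<exists>N. poly_in ((\<lambda>i x. x i) ` I) N f"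
  then obtain N where "poly_in ((\<lambda>i x. x i) ` I) N f" by blast
  then show "complex_poly_fun I f"
    by induction (auto intro: complex_poly_fun.intros)
qed

lemma regular_on_complex_poly_fun:
  assumes "complex_poly_fun I f" "\<And>i. i \<in> I \<Longrightarrow> regular_on S F (g i)"
  shows "regular_on S F (\<lambda>x. f (\<lambda>i. g i x))"
  using assms by (induction rule: complex_poly_fun.induct) auto

text \<open>Equivalently, the map \<open>(f 0, \<dots>, f (d - 1))\<close> sends \<open>S\<close> to a Zariski dense subset of affine \<open>d\<close>-space.
  Over the complex numbers, the polynomial \<open>P\<close> is zero once it vanishes at every point.\<close>

definition alg_indep_on :: "'a set \<Rightarrow> nat \<Rightarrow> (nat \<Rightarrow> 'a \<Rightarrow> complex) \<Rightarrow> bool" where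
  "alg_indep_on S d f \<longleftrightarrow>
     (\<forall>P. complex_poly_fun {..<d} P \<longrightarrow> (\<forall>x\<in>S. P (\<lambda>i. f i x) = 0) \<longrightarrow> (\<forall>y. P y = 0))"

lemma alg_indep_on_mono:
  "alg_indep_on S d f \<Longrightarrow> S \<subseteq> T \<Longrightarrow> e \<le> d \<Longrightarrow> alg_indep_on T e f"
  unfolding alg_indep_on_def
  by (metis complex_poly_fun_mono lessThan_subset_iff subsetD)

lemma sum_digits: "(\<Sum>i<k. (m div N ^ i mod N) * N ^ i) = m mod N ^ k" for m N :: nat
proof (induction k)
  case (Suc k)
  have "m mod N ^ Suc k = N ^ k * (m div N ^ k mod N) + m mod N ^ k"
    by (simp add: mod_mult2_eq mult.commute[of N])
  with Suc show ?case by (simp add: mult.commute)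
qed simp

text \<open>There are \<open>N ^ (D + 1)\<close> monomials in \<open>f 0, \<dots>, f D\<close> with all exponents below \<open>N\<close>, and their degree is
  \<open>O(N)\<close>, so that the functions of this degree span a space of dimension \<open>O(N ^ D)\<close>.  For large \<open>N\<close> the
  monomials are linearly dependent.\<close>

lemma growth_at_most_dependent:
  assumes "growth_at_most S F D" "\<And>i. i \<le> D \<Longrightarrow> regular_on S F (f i)"
  shows "\<not> alg_indep_on S (Suc D) f"
proof
  assume indep: "alg_indep_on S (Suc D) f"
  obtain C where C: "\<And>N. \<exists>W. finite W \<and> card W \<le> C * (N + 1) ^ D \<and>
     (\<forall>f. poly_in F N f \<longrightarrow> spanned_on S W f)" using assms(1) unfolding growth_at_most_def by blast
  have "\<exists>e. \<forall>g\<in>f ` {..D}. \<exists>h. poly_in F e h \<and> (\<forall>x\<in>S. g x = h x)"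
    by (rule regular_on_uniform) (use assms(2) in auto)
  then obtain e where "\<forall>i\<le>D. \<exists>h. poly_in F e h \<and> (\<forall>x\<in>S. f i x = h x)" by auto
  then obtain h where h: "\<And>i. i \<le> D \<Longrightarrow> poly_in F e (h i)" "\<And>i x. i \<le> D \<Longrightarrow> x \<in> S \<Longrightarrow> f i x = h i x"
    by metis
  \<comment> \<open>Chosen so that \<open>C * (N * (e * Suc D + 1)) ^ D = (N - 1) * N ^ D\<close>.\<close>
  define N where "N = C * (e * Suc D + 1) ^ D + 1"
  have N: "N > 0" unfolding N_def by simp
  \<comment> \<open>The exponent vectors are the base \<open>N\<close> digits of the numbers below \<open>N ^ Suc D\<close>.\<close>
  define dig where "dig = (\<lambda>m i. m div N ^ i mod N)"
  define mon where "mon = (\<lambda>m x. \<Prod>i<Suc D. h i x ^ dig m i)"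
  obtain W where W: "finite W" "card W \<le> C * (e * N * Suc D + 1) ^ D"
    "\<And>g. poly_in F (e * N * Suc D) g \<Longrightarrow> spanned_on S W g" using C by blast
  have mon: "spanned_on S W (mon m)" for m
  proof -
    have "poly_in F (e * N) (\<lambda>x. h i x ^ dig m i)" if "i < Suc D" for i
    proof (rule poly_in_mono[OF poly_in_power[OF h(1)]])
      show "e * dig m i \<le> e * N" using N by (simp add: dig_def less_imp_le)
    qed (use that in simp)
    then have "poly_in F (e * N * card {..<Suc D}) (mon m)"
      unfolding mon_def by (intro poly_in_prod) simp
    then show ?thesis by (intro W(3)) simp
  qed
  have "card W \<le> C * (e * N * Suc D + 1) ^ D" by (rule W(2))
  also have "\<dots> \<le> C * (N * (e * Suc D + 1)) ^ D"
    using N by (intro mult_left_mono power_mono) (auto simp: algebra_simps)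
  also have "\<dots> = (N - 1) * N ^ D" unfolding power_mult_distrib by (simp add: N_def)
  also have "\<dots> < N ^ Suc D" using N by simp
  finally have "card W < card {..<N ^ Suc D}" by simp
  then obtain d where d: "\<exists>m\<in>{..<N ^ Suc D}. d m \<noteq> 0"
    "\<forall>x\<in>S. (\<Sum>m<N ^ Suc D. d m * mon m x) = 0"
    using spanned_on_dependent[of W "{..<N ^ Suc D}" S mon] W(1) mon by auto
  define P where "P = (\<lambda>y. \<Sum>m<N ^ Suc D. d m * (\<Prod>i<Suc D. y i ^ dig m i))"
  have "complex_poly_fun {..<Suc D} P" unfolding P_def
    by (intro complex_poly_fun_sum complex_poly_fun.mult complex_poly_fun.const
        complex_poly_fun_prod complex_poly_fun_power complex_poly_fun.coord)
  moreover have "P (\<lambda>i. f i x) = 0" if "x \<in> S" for x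
  proof -
    have "P (\<lambda>i. f i x) = (\<Sum>m<N ^ Suc D. d m * mon m x)"
      unfolding P_def mon_def using h(2) that
      by (intro sum.cong prod.cong refl arg_cong2[where f = "(*)"]) auto
    then show ?thesis using d(2) that by simp
  qed
  ultimately have zero: "P y = 0" for y using indep unfolding alg_indep_on_def by blast
  \<comment> \<open>Kronecker substitution \<open>y i = t ^ (N ^ i)\<close>: the monomial with number \<open>m\<close> becomes \<open>t ^ m\<close>.\<close>
  have "(\<Sum>m\<le>N ^ Suc D - 1. d m * t ^ m) = 0" for t
  proof -
    have "(\<Prod>i<Suc D. (t ^ N ^ i) ^ dig m i) = t ^ m" if "m < N ^ Suc D" for m
    proof -
      have "(\<Prod>i<Suc D. (t ^ N ^ i) ^ dig m i) = t ^ (\<Sum>i<Suc D. dig m i * N ^ i)"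
        unfolding power_sum by (simp add: power_mult[symmetric] mult.commute)
      also have "\<dots> = t ^ m" using sum_digits[of m N "Suc D"] that by (simp only: dig_def mod_less)
      finally show ?thesis .
    qed
    then have "P (\<lambda>i. t ^ N ^ i) = (\<Sum>m<N ^ Suc D. d m * t ^ m)"
      unfolding P_def by (intro sum.cong) auto
    moreover have "{..<N ^ Suc D} = {..N ^ Suc D - 1}"
    proof -
      have "N ^ Suc D > 0" using N by (rule zero_less_power)
      then have "N ^ Suc D = Suc (N ^ Suc D - 1)" by linarith
      then show ?thesis by (metis lessThan_Suc_atMost)
    qed
    ultimately show ?thesis using zero by simp
  qed
  then have "\<forall>m\<le>N ^ Suc D - 1. d m = 0" using polyfun_eq_0[of d] by blast
  with d(1) show False by auto
qed

text \<open>The functions on \<open>Z\<close> form an integral domain.  For subsets of affine space this is irreducibility, but it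
  passes from \<open>Z\<close> to its Zariski closure without any topology, and it can be checked on a
  parametrisation.\<close>

definition integral_set :: "'i set \<Rightarrow> ('i \<Rightarrow> complex) set \<Rightarrow> bool" where
  "integral_set I Z \<longleftrightarrow> Z \<noteq> {} \<and>
     (\<forall>a b. complex_poly_fun I a \<and> complex_poly_fun I b \<and> (\<forall>x\<in>Z. a x * b x = 0) \<longrightarrow>
       (\<forall>x\<in>Z. a x = 0) \<or> (\<forall>x\<in>Z. b x = 0))"

text \<open>This is the reason why the transcendence degree increases strictly along a chain of irreducible sets.
  Suppose that a polynomial \<open>P = h\<^sub>0 + h\<^sub>1 y + \<dots>\<close> with coefficients in the first \<open>d\<close> variables
  vanishes at \<open>(f, g)\<close> on \<open>Z'\<close>.  On \<open>Z\<close>, where \<open>g = 0\<close>, only \<open>h\<^sub>0(f)\<close> is left, and so \<open>h\<^sub>0 = 0\<close> by the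
  independence of \<open>f\<close>.  Since \<open>g\<close> is not zero on \<open>Z'\<close> and the functions on \<open>Z'\<close> form a domain, the remaining
  sum can be divided by \<open>g\<close>, and the argument repeats.\<close>

lemma alg_indep_on_extend:
  assumes indep: "alg_indep_on Z d f" and Z': "integral_set I Z'" "Z \<subseteq> Z'"
    and f: "\<And>i. i < d \<Longrightarrow> complex_poly_fun I (f i)" and g: "complex_poly_fun I g"
    and gZ: "\<And>x. x \<in> Z \<Longrightarrow> g x = 0" and gZ': "z \<in> Z'" "g z \<noteq> 0"
  shows "alg_indep_on Z' (Suc d) (f(d := g))"
proof -
  have *: "\<forall>k\<le>K. \<forall>y. h k y = 0"
    if "\<And>k. complex_poly_fun {..<d} (h k)"
      "\<forall>x\<in>Z'. (\<Sum>k\<le>K. h k (\<lambda>i. f i x) * g x ^ k) = 0" for K h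
    using that
  proof (induction K arbitrary: h)
    case 0
    then have "\<forall>x\<in>Z. h 0 (\<lambda>i. f i x) = 0" using Z'(2) by auto
    then show ?case using indep 0(1) unfolding alg_indep_on_def by auto
  next
    case (Suc K)
    have shift: "(\<Sum>k\<le>Suc K. h k (\<lambda>i. f i x) * g x ^ k) =
        h 0 (\<lambda>i. f i x) + g x * (\<Sum>k\<le>K. h (Suc k) (\<lambda>i. f i x) * g x ^ k)" for x
      by (simp add: sum.atMost_Suc_shift sum_distrib_left mult_ac del: sum.atMost_Suc)
    have "h 0 (\<lambda>i. f i x) = 0" if "x \<in> Z" for x
      using bspec[OF Suc.prems(2)[unfolded shift] subsetD[OF Z'(2) that]] gZ[OF that] by simp
    then have h0: "h 0 y = 0" for y using indep Suc.prems(1) unfolding alg_indep_on_def by blast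
    let ?r = "\<lambda>x. \<Sum>k\<le>K. h (Suc k) (\<lambda>i. f i x) * g x ^ k"
    have "\<forall>x\<in>Z'. g x * ?r x = 0"
      using Suc.prems(2) unfolding shift h0 by simp
    moreover have "complex_poly_fun I (\<lambda>x. h (Suc k) (\<lambda>i. f i x))" for k
      by (rule complex_poly_fun_compose[OF Suc.prems(1)]) (use f in auto)
    moreover have "complex_poly_fun I ?r"
      using calculation(2) by (intro complex_poly_fun_sum complex_poly_fun.mult complex_poly_fun_power g) simp
    ultimately have "(\<forall>x\<in>Z'. g x = 0) \<or> (\<forall>x\<in>Z'. ?r x = 0)"
      using Z'(1) g unfolding integral_set_def by blast
    then have "\<forall>x\<in>Z'. ?r x = 0" using gZ' by blast
    then have "\<forall>k\<le>K. \<forall>y. h (Suc k) y = 0" using Suc.IH[of "\<lambda>k. h (Suc k)"] Suc.prems(1) by blast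
    with h0 show ?case by (metis Suc_le_mono not0_implies_Suc)
  qed
  show ?thesis unfolding alg_indep_on_def
  proof (intro allI impI)
    fix P y assume P: "complex_poly_fun {..<Suc d} P" "\<forall>x\<in>Z'. P (\<lambda>i. (f(d := g)) i x) = 0"
    have "(\<lambda>i x. x i) ` {..<Suc d} = insert (\<lambda>x::nat \<Rightarrow> complex. x d) ((\<lambda>i x. x i) ` {..<d})"
      by (simp add: lessThan_Suc)
    moreover obtain N where "poly_in ((\<lambda>i x. x i) ` {..<Suc d}) N P"
      using P(1)[unfolded complex_poly_fun_iff_poly_in] by blast
    ultimately have "poly_in (insert (\<lambda>x. x d) ((\<lambda>i x. x i) ` {..<d})) N P" by simp
    then obtain h where h: "\<forall>k. poly_in ((\<lambda>i x. x i) ` {..<d}) N (h k)"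
      "\<forall>x. P x = (\<Sum>k\<le>N. h k x * x d ^ k)"
      using poly_in_insert_expand[of "\<lambda>x. x d"] by blast
    have hp: "complex_poly_fun {..<d} (h k)" for k
      using h(1) complex_poly_fun_iff_poly_in by blast
    have "h k (\<lambda>i. (f(d := g)) i x) = h k (\<lambda>i. f i x)" for k x
      by (rule complex_poly_fun_cong[OF hp]) auto
    then have "\<forall>x\<in>Z'. (\<Sum>k\<le>N. h k (\<lambda>i. f i x) * g x ^ k) = 0"
      using P(2) h(2) by simp
    then have "\<forall>k\<le>N. \<forall>y. h k y = 0" using *[of h N] hp by blast
    then show "P y = 0" using h(2) by simp
  qed
qed

lemma closedin_affine:
  assumes "V \<subseteq> PiE I (\<lambda>_. UNIV)"
  shows "closedin (subtopology (zariski I) V) Z \<longleftrightarrow>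
    (\<exists>F \<subseteq> Collect (complex_poly_fun I). Z = {x \<in> V. \<forall>f\<in>F. f x = 0})"
proof -
  have "zero_locus I F \<inter> V = {x \<in> V. \<forall>f\<in>F. f x = 0}" for F
    using assms by (auto simp: zero_locus_def)
  then show ?thesis unfolding closedin_subtopology closedin_zariski by (smt (verit))
qed

lemma topspace_subtopology_zariski:
  assumes "V \<subseteq> PiE I (\<lambda>_. UNIV)"
  shows "topspace (subtopology (zariski I) V) = V"
proof -
  have "closedin (subtopology (zariski I) V) V"
    unfolding closedin_affine[OF assms] by (rule exI[of _ "{}"]) auto
  then have "V \<subseteq> topspace (subtopology (zariski I) V)" by (rule closedin_subset)
  then show ?thesis by (simp add: Int_absorb1)
qed

lemma irreducible_space_iff_integral_set:
  assumes "Z \<subseteq> PiE I (\<lambda>_. UNIV)"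
  shows "irreducible_space (subtopology (zariski I) Z) \<longleftrightarrow> integral_set I Z"
proof
  assume irr: "irreducible_space (subtopology (zariski I) Z)"
  show "integral_set I Z" unfolding integral_set_def
  proof (intro conjI allI impI)
    show "Z \<noteq> {}" using irr unfolding irreducible_space_def topspace_subtopology_zariski[OF assms] by simp
    fix a b assume ab: "complex_poly_fun I a \<and> complex_poly_fun I b \<and> (\<forall>x\<in>Z. a x * b x = 0)"
    have "closedin (subtopology (zariski I) Z) {x \<in> Z. c x = 0}" if "complex_poly_fun I c" for c
      unfolding closedin_affine[OF assms] by (rule exI[of _ "{c}"]) (use that in auto)
    moreover have "{x \<in> Z. a x = 0} \<union> {x \<in> Z. b x = 0} = Z" using ab by auto
    ultimately have "{x \<in> Z. a x = 0} = Z \<or> {x \<in> Z. b x = 0} = Z"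
      using irr ab unfolding irreducible_space_def topspace_subtopology_zariski[OF assms] by meson
    then show "(\<forall>x\<in>Z. a x = 0) \<or> (\<forall>x\<in>Z. b x = 0)" by blast
  qed
next
  assume int: "integral_set I Z"
  show "irreducible_space (subtopology (zariski I) Z)"
    unfolding irreducible_space_def topspace_subtopology_zariski[OF assms]
  proof (intro conjI allI impI)
    show "Z \<noteq> {}" using int unfolding integral_set_def by simp
    fix A B assume AB: "closedin (subtopology (zariski I) Z) A \<and>
      closedin (subtopology (zariski I) Z) B \<and> A \<union> B = Z"
    then obtain F G where F: "F \<subseteq> Collect (complex_poly_fun I)" "A = {x \<in> Z. \<forall>f\<in>F. f x = 0}"
      and G: "G \<subseteq> Collect (complex_poly_fun I)" "B = {x \<in> Z. \<forall>f\<in>G. f x = 0}"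
      unfolding closedin_affine[OF assms] by blast
    show "A = Z \<or> B = Z"
    proof (rule ccontr)
      assume "\<not> (A = Z \<or> B = Z)"
      then obtain f g x y where fg: "f \<in> F" "g \<in> G" "x \<in> Z" "y \<in> Z" "f x \<noteq> 0" "g y \<noteq> 0"
        using F(2) G(2) by blast
      have "\<forall>x\<in>Z. f x * g x = 0"
      proof
        fix z assume "z \<in> Z"
        then have "z \<in> A \<or> z \<in> B" using AB by blast
        then show "f z * g z = 0" using F(2) G(2) fg(1,2) by auto
      qed
      moreover have "complex_poly_fun I f" "complex_poly_fun I g" using F(1) G(1) fg by auto
      ultimately show False using int fg unfolding integral_set_def by meson
    qed
  qed
qed

lemma alg_indep_on_0: "Z \<noteq> {} \<Longrightarrow> alg_indep_on Z 0 f"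
proof -
  assume "Z \<noteq> {}"
  then obtain x where x: "x \<in> Z" by blast
  have "P y = 0" if "complex_poly_fun {..<0} P" "\<forall>x\<in>Z. P (\<lambda>i. f i x) = 0" for P y
    using complex_poly_fun_cong[OF that(1), of y "\<lambda>i. f i x"] that(2) x by simp
  then show ?thesis unfolding alg_indep_on_def by blast
qed

text \<open>A chain of length \<open>m\<close> starts with the empty family, independent on any nonempty set, and each strict
  inclusion adds one function to it by \<open>alg_indep_on_extend\<close>.\<close>

theorem affine_dim_of_le:
  assumes V: "V \<subseteq> PiE I (\<lambda>_. UNIV)"
    and dep: "\<And>f. (\<And>i. i \<le> D \<Longrightarrow> complex_poly_fun I (f i)) \<Longrightarrow> \<not> alg_indep_on V (Suc D) f"
  shows "affine_dim_of I V \<le> enat D"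
  unfolding affine_dim_of_def krull_dim_def
proof (rule Sup_least, safe)
  fix m Z
  assume Z: "\<forall>i\<le>m. closedin (subtopology (zariski I) V) (Z i) \<and>
      irreducible_space (subtopology (subtopology (zariski I) V) (Z i))"
    and strict: "\<forall>i<m. Z i \<subset> Z (Suc i)"
  have ZV: "Z i \<subseteq> V" if "i \<le> m" for i
    using Z that closedin_affine[OF V] by blast
  have int: "integral_set I (Z i)" if "i \<le> m" for i
  proof -
    have "subtopology (subtopology (zariski I) V) (Z i) = subtopology (zariski I) (Z i)"
      using ZV[OF that] by (simp add: subtopology_subtopology inf.absorb2)
    moreover have "irreducible_space (subtopology (subtopology (zariski I) V) (Z i))"
      using Z that by blast
    ultimately show ?thesis
      using irreducible_space_iff_integral_set[OF subset_trans[OF ZV[OF that] V]] by simp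
  qed
  have "\<exists>f. (\<forall>j<i. complex_poly_fun I (f j)) \<and> alg_indep_on (Z i) i f" if "i \<le> m" for i
    using that
  proof (induction i)
    case 0
    have "Z 0 \<noteq> {}" using int[of 0] unfolding integral_set_def by simp
    then show ?case using alg_indep_on_0[of "Z 0" "\<lambda>_ _. 0"] by auto
  next
    case (Suc i)
    then obtain f where f: "\<forall>j<i. complex_poly_fun I (f j)" "alg_indep_on (Z i) i f" by auto
    obtain F where F: "F \<subseteq> Collect (complex_poly_fun I)" "Z i = {x \<in> V. \<forall>f\<in>F. f x = 0}"
      using Z Suc.prems closedin_affine[OF V] by (meson Suc_leD)
    have "Z i \<subset> Z (Suc i)" using strict Suc.prems by simp
    then obtain x where x: "x \<in> Z (Suc i)" "x \<notin> Z i" by blast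
    then obtain g where g: "g \<in> F" "g x \<noteq> 0" using F(2) ZV[OF Suc.prems] by blast
    have "alg_indep_on (Z (Suc i)) (Suc i) (f(i := g))"
      by (rule alg_indep_on_extend[where z = x, OF f(2) int[OF Suc.prems]])
        (use x(1) g \<open>Z i \<subset> Z (Suc i)\<close> f(1) F in auto)
    moreover have "\<forall>j<Suc i. complex_poly_fun I ((f(i := g)) j)"
      using f(1) F(1) g(1) by (auto simp: less_Suc_eq)
    ultimately show ?case by blast
  qed
  then obtain f where f: "\<forall>j<m. complex_poly_fun I (f j)" "alg_indep_on (Z m) m f" by blast
  have "m \<le> D"
  proof (rule ccontr)
    assume "\<not> m \<le> D"
    then have "alg_indep_on V (Suc D) f" using alg_indep_on_mono[OF f(2) ZV] by simp
    then show False using dep[of f] f(1) \<open>\<not> m \<le> D\<close> by auto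
  qed
  then show "enat m \<le> enat D" by simp
qed

text \<open>The sets \<open>M j\<close> need not be closed.  Their closures in \<open>V\<close> satisfy the same polynomial equations as the
  sets themselves, hence inherit both integrality and the separating functions.\<close>

theorem affine_dim_of_ge:
  assumes V: "V \<subseteq> PiE I (\<lambda>_. UNIV)"
    and M: "\<And>j. j \<le> m \<Longrightarrow> M j \<subseteq> V" "\<And>j. j \<le> m \<Longrightarrow> integral_set I (M j)"
      "\<And>j. j < m \<Longrightarrow> M j \<subseteq> M (Suc j)"
    and sep: "\<And>j. j < m \<Longrightarrow> \<exists>g x. complex_poly_fun I g \<and> (\<forall>y\<in>M j. g y = 0) \<and> x \<in> M (Suc j) \<and> g x \<noteq> 0"
  shows "enat m \<le> affine_dim_of I V"
proof -
  define F where "F = (\<lambda>j. {f. complex_poly_fun I f \<and> (\<forall>y\<in>M j. f y = 0)})"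
  define Z where "Z = (\<lambda>j. {x \<in> V. \<forall>f\<in>F j. f x = 0})"
  have MZ: "M j \<subseteq> Z j" if "j \<le> m" for j using M(1)[OF that] unfolding Z_def F_def by auto
  have ZV: "Z j \<subseteq> V" for j unfolding Z_def by auto
  have vanish: "\<forall>x\<in>Z j. a x = 0" if "complex_poly_fun I a" "\<forall>x\<in>M j. a x = 0" for a j
    using that unfolding Z_def F_def by auto
  have closed: "closedin (subtopology (zariski I) V) (Z j)" for j
    unfolding closedin_affine[OF V] by (rule exI[of _ "F j"]) (auto simp: Z_def F_def)
  have "integral_set I (Z j)" if j: "j \<le> m" for j
    unfolding integral_set_def
  proof (intro conjI allI impI)
    show "Z j \<noteq> {}" using M(2)[OF j] MZ[OF j] unfolding integral_set_def by auto
    fix a b assume ab: "complex_poly_fun I a \<and> complex_poly_fun I b \<and> (\<forall>x\<in>Z j. a x * b x = 0)"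
    then have "(\<forall>x\<in>M j. a x = 0) \<or> (\<forall>x\<in>M j. b x = 0)"
      using M(2)[OF j] MZ[OF j] unfolding integral_set_def by blast
    then show "(\<forall>x\<in>Z j. a x = 0) \<or> (\<forall>x\<in>Z j. b x = 0)" using vanish ab by blast
  qed
  then have "irreducible_space (subtopology (subtopology (zariski I) V) (Z j))" if "j \<le> m" for j
    using irreducible_space_iff_integral_set[OF subset_trans[OF ZV[of j] V]] ZV[of j] that
    by (simp add: subtopology_subtopology inf.absorb2)
  moreover have "Z j \<subset> Z (Suc j)" if j: "j < m" for j
  proof -
    have "F (Suc j) \<subseteq> F j" using M(3)[OF j] unfolding F_def by blast
    then have "Z j \<subseteq> Z (Suc j)" unfolding Z_def by blast
    moreover obtain g x where "complex_poly_fun I g" "\<forall>y\<in>M j. g y = 0" "x \<in> M (Suc j)" "g x \<noteq> 0"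
      using sep[OF j] by blast
    ultimately show ?thesis using vanish[of g j] MZ[of "Suc j"] j by auto
  qed
  ultimately show ?thesis unfolding affine_dim_of_def krull_dim_def
    by (intro Sup_upper) (use closed in blast)
qed

section \<open>Two-by-two matrices and Chebyshev polynomials\<close>

definition mat2 :: "complex \<Rightarrow> complex \<Rightarrow> complex \<Rightarrow> complex \<Rightarrow> complex^2^2" where
  "mat2 a b c d = vector [vector [a, b], vector [c, d]]"

lemma mat2_entries [simp]:
  "mat2 a b c d $ 1 $ 1 = a" "mat2 a b c d $ 1 $ 2 = b"
  "mat2 a b c d $ 2 $ 1 = c" "mat2 a b c d $ 2 $ 2 = d"
  by (simp_all add: mat2_def vector_2)

lemma matrix_mult_entry_2:
  fixes A B :: "complex^2^2"
  shows "(A ** B) $ i $ j = A $ i $ 1 * B $ 1 $ j + A $ i $ 2 * B $ 2 $ j"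
  by (simp add: matrix_matrix_mult_def sum_2)

lemma mat_entries_2 [simp]:
  "(mat c :: complex^2^2) $ 1 $ 1 = c" "(mat c :: complex^2^2) $ 1 $ 2 = 0"
  "(mat c :: complex^2^2) $ 2 $ 1 = 0" "(mat c :: complex^2^2) $ 2 $ 2 = c"
  by (simp_all add: mat_def)

lemma matrix_eq_2: "(A :: complex^2^2) = B \<longleftrightarrow> A $ 1 $ 1 = B $ 1 $ 1 \<and> A $ 1 $ 2 = B $ 1 $ 2 \<and>
    A $ 2 $ 1 = B $ 2 $ 1 \<and> A $ 2 $ 2 = B $ 2 $ 2"
  by (auto simp: vec_eq_iff forall_2)

lemma trace_2: "trace (A :: complex^2^2) = A $ 1 $ 1 + A $ 2 $ 2"
  by (simp add: trace_def sum_2)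

text \<open>The adjugate, which is the inverse for matrices of determinant \<open>1\<close>.  Unlike the inverse, its
  entries are polynomials.\<close>

definition adj2 :: "complex^2^2 \<Rightarrow> complex^2^2" where
  "adj2 A = mat2 (A $ 2 $ 2) (- A $ 1 $ 2) (- A $ 2 $ 1) (A $ 1 $ 1)"

lemma det_adj2 [simp]: "det (adj2 A) = det A"
  by (simp add: adj2_def det_2)

lemma adj2_inverse:
  assumes "det A = 1" shows "A ** adj2 A = mat 1" "adj2 A ** A = mat 1"
  using assms by (simp_all add: matrix_eq_2 matrix_mult_entry_2 adj2_def det_2 algebra_simps)

lemma adj2_mult: "adj2 (A ** B) = adj2 B ** adj2 A"
  by (simp add: matrix_eq_2 matrix_mult_entry_2 adj2_def algebra_simps)

lemma adj2_unique:
  assumes "det A = 1" "B ** A = mat 1" shows "B = adj2 A"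
  by (metis assms adj2_inverse(1) matrix_mul_assoc matrix_mul_lid matrix_mul_rid)

primrec mpow :: "complex^2^2 \<Rightarrow> nat \<Rightarrow> complex^2^2" where
  "mpow A 0 = mat 1"
| "mpow A (Suc k) = A ** mpow A k"

lemma det_mpow: "det (mpow A k) = det A ^ k"
  by (induction k) (simp_all add: det_mul)

lemma mpow_commute: "A ** mpow A k = mpow A k ** A"
  by (induction k) (simp_all add: matrix_mul_assoc)

lemma mpow_adj2: "mpow (adj2 A) k = adj2 (mpow A k)"
proof (induction k)
  case 0
  show ?case by (simp add: adj2_def matrix_eq_2)
next
  case (Suc k)
  then show ?case by (simp add: adj2_mult mpow_commute)
qed

text \<open>Chebyshev polynomials of the second kind, normalised by
  \<open>U\<^sub>k(x + 1/x) = (x ^ k - 1/x ^ k) / (x - 1/x)\<close>.\<close>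

fun chebU :: "nat \<Rightarrow> complex poly" where
  "chebU 0 = 0"
| "chebU (Suc 0) = 1"
| "chebU (Suc (Suc k)) = pCons 0 (chebU (Suc k)) - chebU k"

text \<open>Chebyshev polynomials of the first kind, normalised to be monic: \<open>T\<^sub>k(x + 1/x) = x ^ k + 1/x ^ k\<close>.\<close>

fun chebT :: "nat \<Rightarrow> complex poly" where
  "chebT 0 = [:2:]"
| "chebT (Suc 0) = [:0, 1:]"
| "chebT (Suc (Suc k)) = pCons 0 (chebT (Suc k)) - chebT k"

lemma chebT_monic: "degree (chebT (Suc k)) = Suc k \<and> coeff (chebT (Suc k)) (Suc k) = 1"
proof (induction k rule: chebT.induct)
  case (3 k)
  have d: "degree (pCons 0 (chebT (Suc (Suc k)))) = Suc (Suc (Suc k))"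
    using 3(1) by (auto simp: degree_pCons_eq_if)
  have "degree (chebT (Suc (Suc (Suc k)))) = degree (pCons 0 (chebT (Suc (Suc k))))"
    unfolding chebT.simps(3)[of "Suc k"]
    using 3(2) d by (subst diff_conv_add_uminus, intro degree_add_eq_left) simp
  moreover have "coeff (chebT (Suc k)) (Suc (Suc (Suc k))) = 0"
    using 3(2) by (intro coeff_eq_0) simp
  ultimately show ?case
    using d 3(1) unfolding chebT.simps(3)[of "Suc k"] by simp
qed (auto simp: numeral_2_eq_2)

lemma chebT_chebU: "chebT (Suc k) = chebU (Suc (Suc k)) - chebU k"
proof (induction k rule: chebT.induct)
  case (3 k)
  have "pCons 0 (chebU (Suc k)) = chebU (Suc (Suc k)) + chebU k" by simp
  moreover have "pCons 0 (chebU (Suc (Suc (Suc k))) - chebU (Suc k)) =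
      pCons 0 (chebU (Suc (Suc (Suc k)))) - pCons 0 (chebU (Suc k))"
    by (simp del: chebU.simps)
  ultimately show ?case
    unfolding chebT.simps(3)[of "Suc k"] 3 chebU.simps(3)[of "Suc (Suc k)"]
    by (simp del: chebU.simps)
qed (auto simp: one_pCons)

text \<open>The analogue of Cassini's identity for Fibonacci numbers; it expresses \<open>det (A ^ k) = 1\<close> in terms of
  traces.\<close>

lemma chebU_cassini: "poly (chebU (Suc k)) t ^ 2 - poly (chebU k) t * poly (chebU (Suc (Suc k))) t = 1"
proof (induction k)
  case (Suc k)
  then show ?case by (simp add: power2_eq_square algebra_simps)
qed simp

text \<open>The Cayley--Hamilton theorem \<open>A ^ 2 = t A - 1\<close>, iterated.\<close>

lemma mpow_chebU:
  assumes "det A = 1"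
  shows "mpow A (Suc k) $ i $ j =
    poly (chebU (Suc k)) (trace A) * A $ i $ j - poly (chebU k) (trace A) * mat 1 $ i $ j"
proof (induction k arbitrary: i j)
  case (Suc k)
  have "mpow A (Suc (Suc k)) $ i $ j =
      A $ i $ 1 * mpow A (Suc k) $ 1 $ j + A $ i $ 2 * mpow A (Suc k) $ 2 $ j"
    unfolding mpow.simps(2)[of A "Suc k"] by (rule matrix_mult_entry_2)
  moreover have "A $ i $ 1 * A $ 1 $ j + A $ i $ 2 * A $ 2 $ j = trace A * A $ i $ j - mat 1 $ i $ j"
    using assms exhaust_2[of i] exhaust_2[of j] by (auto simp: det_2 trace_2 algebra_simps)
  moreover have "A $ i $ 1 * mat 1 $ 1 $ j + A $ i $ 2 * mat 1 $ 2 $ j = A $ i $ j"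
    using exhaust_2[of j] by auto
  ultimately show ?case unfolding Suc by (simp add: algebra_simps) algebra
qed simp

lemma trace_mpow: "det A = 1 \<Longrightarrow> trace (mpow A k) = poly (chebT k) (trace A)"
proof (cases k)
  case (Suc m)
  assume "det A = 1"
  then show ?thesis
    unfolding Suc trace_2[of "mpow A (Suc m)"] mpow_chebU[OF \<open>det A = 1\<close>] chebT_chebU
    by (simp add: trace_2 algebra_simps)
qed (simp add: trace_2)

text \<open>By Cayley--Hamilton only the scalar part \<open>- U\<^sub>k\<close> of the power remains, and its square is \<open>1\<close> by the
  Cassini identity.\<close>

lemma mpow_scalar:
  assumes "det A = 1" "poly (chebU (Suc k)) (trace A) = 0"
  shows "mpow A (Suc k) = mat 1 \<or> mpow A (Suc k) = mat (-1)"
proof -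
  let ?v = "poly (chebU k) (trace A)"
  have "?v * ?v = 1"
    using chebU_cassini[of k "trace A"] assms(2) by (simp add: algebra_simps)
  then have "?v = 1 \<or> ?v = -1" by (simp add: square_eq_1_iff)
  then show ?thesis by (auto simp: matrix_eq_2 mpow_chebU[OF assms(1)] assms(2) simp del: mpow.simps)
qed

text \<open>Solving \<open>B = U\<^sub>k\<^sub>+\<^sub>1(t) X - U\<^sub>k(t)\<close> for \<open>X\<close> gives a root of \<open>B\<close> for each admissible trace \<open>t\<close>.  That
  \<open>X\<close> has trace \<open>t\<close> comes from \<open>T\<^sub>k\<^sub>+\<^sub>1 = U\<^sub>k\<^sub>+\<^sub>2 - U\<^sub>k\<close>, and that it has determinant \<open>1\<close> from the
  Cassini identity.\<close>

lemma mpow_root: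
  assumes B: "det B = 1" and t: "poly (chebT (Suc k)) t = trace B" and nz: "poly (chebU (Suc k)) t \<noteq> 0"
  defines "X \<equiv> \<chi> i j. (B $ i $ j + poly (chebU k) t * mat 1 $ i $ j) / poly (chebU (Suc k)) t"
  shows "det X = 1" "mpow X (Suc k) = B"
proof -
  let ?u = "poly (chebU (Suc k)) t" and ?v = "poly (chebU k) t"
  have tB: "B $ 1 $ 1 + B $ 2 $ 2 = t * ?u - 2 * ?v"
    using t by (simp add: chebT_chebU trace_2)
  have "?u ^ 2 - ?v * (t * ?u - ?v) = 1" using chebU_cassini[of k t] by simp
  moreover have "(B $ 1 $ 1 + ?v) * (B $ 2 $ 2 + ?v) - B $ 1 $ 2 * B $ 2 $ 1 =
      1 + ?v * (B $ 1 $ 1 + B $ 2 $ 2) + ?v ^ 2"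
    using B by (simp add: det_2 algebra_simps power2_eq_square)
  moreover have "1 + ?v * (B $ 1 $ 1 + B $ 2 $ 2) + ?v ^ 2 = ?u ^ 2"
    unfolding tB using calculation(1) by (simp add: algebra_simps power2_eq_square)
  ultimately have "(B $ 1 $ 1 + ?v) * (B $ 2 $ 2 + ?v) - B $ 1 $ 2 * B $ 2 $ 1 = ?u ^ 2"
    by simp
  then show det: "det X = 1"
    using nz by (simp add: det_2 X_def power2_eq_square diff_divide_distrib[symmetric])
  have "trace X = (B $ 1 $ 1 + B $ 2 $ 2 + 2 * ?v) / ?u"
    by (simp add: trace_2 X_def add_divide_distrib)
  also have "\<dots> = t" unfolding tB using nz by simp
  finally have tr: "trace X = t" .
  have "mpow X (Suc k) $ i $ j = B $ i $ j" for i j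
    unfolding mpow_chebU[OF det] tr using nz by (simp add: X_def)
  then show "mpow X (Suc k) = B" unfolding vec_eq_iff by blast
qed

definition pprod :: "('x \<Rightarrow> complex^2^2) \<Rightarrow> ('x \<Rightarrow> nat) \<Rightarrow> 'x list \<Rightarrow> complex^2^2" where
  "pprod M p xs = foldr (\<lambda>i B. mpow (M i) (p i) ** B) xs (mat 1)"

lemma pprod_simps [simp]:
  "pprod M p [] = mat 1" "pprod M p (x # xs) = mpow (M x) (p x) ** pprod M p xs"
  by (simp_all add: pprod_def)

lemma pprod_append: "pprod M p (xs @ ys) = pprod M p xs ** pprod M p ys"
  by (induction xs) (simp_all add: matrix_mul_assoc)

lemma det_pprod: "(\<And>x. x \<in> set xs \<Longrightarrow> det (M x) = 1) \<Longrightarrow> det (pprod M p xs) = 1"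
  by (induction xs) (simp_all add: det_mul det_mpow)

lemma pprod_cong:
  "(\<And>x. x \<in> set xs \<Longrightarrow> M x = M' x) \<Longrightarrow> pprod M p xs = pprod M' p xs"
  by (induction xs) simp_all

text \<open>The entries are polynomials with integer coefficients in the given entries.  The predicate \<open>Q\<close> stands for
  being regular, holomorphic or continuous.\<close>

lemma mpow_entry_closed:
  fixes Q :: "('a \<Rightarrow> complex) \<Rightarrow> bool"
  assumes const: "\<And>c. Q (\<lambda>_. c)"
    and add: "\<And>f g. Q f \<Longrightarrow> Q g \<Longrightarrow> Q (\<lambda>z. f z + g z)"
    and mult: "\<And>f g. Q f \<Longrightarrow> Q g \<Longrightarrow> Q (\<lambda>z. f z * g z)"
    and A: "\<And>i j. Q (\<lambda>z. A z $ i $ j)"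
  shows "Q (\<lambda>z. mpow (A z) k $ i $ j)"
proof (induction k arbitrary: i j)
  case 0
  show ?case using const by simp
next
  case (Suc k)
  show ?case unfolding mpow.simps matrix_mult_entry_2 by (intro add mult A Suc)
qed

lemma pprod_entry_closed:
  fixes Q :: "('a \<Rightarrow> complex) \<Rightarrow> bool"
  assumes const: "\<And>c. Q (\<lambda>_. c)"
    and add: "\<And>f g. Q f \<Longrightarrow> Q g \<Longrightarrow> Q (\<lambda>z. f z + g z)"
    and mult: "\<And>f g. Q f \<Longrightarrow> Q g \<Longrightarrow> Q (\<lambda>z. f z * g z)"
    and M: "\<And>x i j. x \<in> set xs \<Longrightarrow> Q (\<lambda>z. M z x $ i $ j)"
  shows "Q (\<lambda>z. pprod (M z) p xs $ i $ j)"
  using M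
proof (induction xs arbitrary: i j)
  case Nil
  show ?case using const by simp
next
  case (Cons x xs)
  have "Q (\<lambda>z. mpow (M z x) (p x) $ i $ j)" for i j
    by (rule mpow_entry_closed[where Q = Q, OF const add mult]) (use Cons.prems in auto)
  moreover have "Q (\<lambda>z. pprod (M z) p xs $ i $ j)" for i j
    using Cons by simp
  ultimately show ?case unfolding pprod_simps matrix_mult_entry_2 by (intro add mult)
qed

section \<open>The representation variety by matrix equations\<close>

definition word_val :: "('x \<Rightarrow> complex^2^2) \<Rightarrow> 'x word \<Rightarrow> complex^2^2" where
  "word_val M w = foldr (\<lambda>(x, b) B. (if b then adj2 (M x) else M x) ** B) w (mat 1)"

lemma word_val_simps [simp]:
  "word_val M [] = mat 1"
  "word_val M ((x, b) # w) = (if b then adj2 (M x) else M x) ** word_val M w"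
  by (simp_all add: word_val_def)

lemma word_val_append: "word_val M (u @ v) = word_val M u ** word_val M v"
  by (induction u) (auto simp: matrix_mul_assoc)

lemma word_val_power_word: "word_val M (power_word n p) = pprod M p [1..<Suc n]"
proof -
  have rep: "word_val M (replicate k (i, False)) = mpow (M i) k" for k i
    by (induction k) simp_all
  have "word_val M (concat (map (\<lambda>i. replicate (p i) (i, False)) xs)) = pprod M p xs" for xs
    by (induction xs) (simp_all add: word_val_append rep)
  then show ?thesis unfolding power_word_def .
qed

lemma det_word_val:
  assumes "\<And>x. x \<in> X \<Longrightarrow> det (M x) = 1" "w \<in> lists (X \<times> UNIV)"
  shows "det (word_val M w) = 1"
  using assms(2) by (induction w) (auto simp: det_mul assms(1))

lemma word_val_pres_cong:
  assumes "(u, v) \<in> pres_cong X R" "\<And>x. x \<in> X \<Longrightarrow> det (M x) = 1"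
    "\<And>r. r \<in> R \<Longrightarrow> r \<in> lists (X \<times> UNIV) \<Longrightarrow> word_val M r = mat 1"
  shows "word_val M u = word_val M v"
  using assms(1)
  by induction (auto simp: assms(2,3) word_val_append adj2_inverse)

definition mat_at :: "('i \<times> 2 \<times> 2 \<Rightarrow> complex) \<Rightarrow> 'i \<Rightarrow> complex^2^2" where
  "mat_at z i = (\<chi> j k. z (i, j, k))"

lemma mat_at_entries [simp]: "mat_at z i $ j $ k = z (i, j, k)"
  by (simp add: mat_at_def)

lemma pres_cong_class_eq:
  "(u, v) \<in> pres_cong X R \<Longrightarrow> pres_cong X R `` {u} = pres_cong X R `` {v}"
  by (blast intro: pres_cong.sym pres_cong.trans)

lemma presented_group_mult:
  assumes "u \<in> lists (X \<times> UNIV)" "v \<in> lists (X \<times> UNIV)"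
  shows "monoid.mult (presented_group X R) (pres_cong X R `` {u}) (pres_cong X R `` {v}) =
    pres_cong X R `` {u @ v}"
proof -
  let ?C = "\<lambda>u. pres_cong X R `` {u}"
  have "?C (u' @ v') = ?C (u @ v)" if "u' \<in> ?C u" "v' \<in> ?C v" for u' v'
  proof -
    have "(u @ v, u' @ v') \<in> pres_cong X R" using that by (intro pres_cong.append) simp_all
    then show ?thesis by (rule pres_cong_class_eq[symmetric])
  qed
  then have "(\<Union>u'\<in>?C u. \<Union>v'\<in>?C v. ?C (u' @ v')) = (\<Union>u'\<in>?C u. \<Union>v'\<in>?C v. ?C (u @ v))"
    by (metis (no_types, lifting) SUP_cong)
  moreover have "u \<in> ?C u" "v \<in> ?C v"
    using pres_cong.refl[OF assms(1)] pres_cong.refl[OF assms(2)] by simp_all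
  then have "?C u \<noteq> {}" "?C v \<noteq> {}" by blast+
  ultimately show ?thesis unfolding presented_group_def by simp
qed

text \<open>The universal property of the presented group.  A homomorphism is evaluated on words by induction on
  their length.  Conversely, matrices that satisfy the relators define a homomorphism by evaluating
  any representative of a class, which is well defined by \<open>word_val_pres_cong\<close>.\<close>

lemma rep_variety_presented_group:
  "rep_variety (presented_group X R) X (pres_gen X R) =
     {z \<in> PiE (X \<times> UNIV \<times> UNIV) (\<lambda>_. UNIV). (\<forall>x\<in>X. det (mat_at z x) = 1) \<and>
        (\<forall>r\<in>R. r \<in> lists (X \<times> UNIV) \<longrightarrow> word_val (mat_at z) r = mat 1)}"
  (is "?V = ?W")
proof
  let ?G = "presented_group X R" and ?C = "\<lambda>u. pres_cong X R `` {u}"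
  show "?V \<subseteq> ?W"
  proof
    fix z assume "z \<in> ?V"
    then obtain \<rho> where \<rho>: "\<rho> \<in> hom ?G SL2C"
      and z: "z = (\<lambda>(i, j, k) \<in> X \<times> UNIV \<times> UNIV. \<rho> (pres_gen X R i) $ j $ k)"
      unfolding rep_variety_def by blast
    have carrier: "?C u \<in> carrier ?G" if "u \<in> lists (X \<times> UNIV)" for u
      using that unfolding presented_group_def by (auto intro: quotientI)
    have det: "det (\<rho> (?C u)) = 1" if "u \<in> lists (X \<times> UNIV)" for u
      using hom_in_carrier[OF \<rho> carrier[OF that]] by (simp add: SL2C_def)
    have mult: "\<rho> (?C (u @ v)) = \<rho> (?C u) ** \<rho> (?C v)"
      if "u \<in> lists (X \<times> UNIV)" "v \<in> lists (X \<times> UNIV)" for u v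
      using hom_mult[OF \<rho> carrier[OF that(1)] carrier[OF that(2)]] presented_group_mult[OF that]
      by (simp add: SL2C_def)
    have one: "\<rho> (?C []) = mat 1"
      using mult[of "[]" "[]"] adj2_inverse(2)[OF det[of "[]"]]
      by (metis append_Nil lists.Nil matrix_mul_assoc matrix_mul_lid)
    have gen: "mat_at z i = \<rho> (?C [(i, False)])" if "i \<in> X" for i
      using that by (simp add: mat_at_def z pres_gen_def vec_eq_iff)
    have letter: "\<rho> (?C [(i, b)]) = (if b then adj2 (mat_at z i) else mat_at z i)" if i: "i \<in> X" for i b
    proof (cases b)
      case True
      have "\<rho> (?C [(i, True)]) ** \<rho> (?C [(i, False)]) = mat 1"
        using mult[of "[(i, True)]" "[(i, False)]"] i one
          pres_cong_class_eq[OF pres_cong.cancel[of i X True R]] by simp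
      then have "\<rho> (?C [(i, True)]) = adj2 (\<rho> (?C [(i, False)]))"
        using i by (intro adj2_unique det) auto
      then show ?thesis using True gen[OF i] by simp
    qed (simp add: gen[OF i])
    have val: "\<rho> (?C u) = word_val (mat_at z) u" if "u \<in> lists (X \<times> UNIV)" for u
      using that
    proof (induction u)
      case (Cons l u)
      then obtain i b where l: "l = (i, b)" "i \<in> X" by (cases l) auto
      then show ?case using mult[of "[l]" u] Cons letter[OF l(2), of b] by simp
    qed (simp add: one)
    have "word_val (mat_at z) r = mat 1" if "r \<in> R" "r \<in> lists (X \<times> UNIV)" for r
      using val[OF that(2)] one pres_cong_class_eq[OF pres_cong.relator[OF that]] by simp
    moreover have "z \<in> PiE (X \<times> UNIV \<times> UNIV) (\<lambda>_. UNIV)" unfolding z by auto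
    moreover have "det (mat_at z x) = 1" if "x \<in> X" for x
      using gen[OF that] det[of "[(x, False)]"] that by simp
    ultimately show "z \<in> ?W" by blast
  qed
  show "?W \<subseteq> ?V"
  proof
    fix z assume z: "z \<in> ?W"
    define \<rho> where "\<rho> = (\<lambda>A. word_val (mat_at z) (SOME u. u \<in> A))"
    have val: "\<rho> (?C u) = word_val (mat_at z) u" if "u \<in> lists (X \<times> UNIV)" for u
    proof -
      have "u \<in> ?C u" using that pres_cong.refl by blast
      then have "(SOME v. v \<in> ?C u) \<in> ?C u" by (rule someI)
      then have "(u, SOME v. v \<in> ?C u) \<in> pres_cong X R" by blast
      then have "word_val (mat_at z) u = word_val (mat_at z) (SOME v. v \<in> ?C u)"
        by (rule word_val_pres_cong) (use z in auto)
      then show ?thesis unfolding \<rho>_def by simp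
    qed
    have cls: "\<exists>u\<in>lists (X \<times> UNIV). A = ?C u" if "A \<in> carrier ?G" for A
      using that unfolding presented_group_def by (auto elim: quotientE)
    have "\<rho> \<in> hom ?G SL2C"
    proof (rule homI)
      fix A assume "A \<in> carrier ?G"
      then obtain u where u: "u \<in> lists (X \<times> UNIV)" "A = ?C u" using cls by blast
      show "\<rho> A \<in> carrier SL2C"
        using det_word_val[OF _ u(1), of "mat_at z"] z by (simp add: u(2) val[OF u(1)] SL2C_def)
    next
      fix A B assume "A \<in> carrier ?G" "B \<in> carrier ?G"
      then obtain u v where u: "u \<in> lists (X \<times> UNIV)" "A = ?C u"
        and v: "v \<in> lists (X \<times> UNIV)" "B = ?C v" using cls by meson
      have "u @ v \<in> lists (X \<times> UNIV)" using u(1) v(1) by auto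
      then show "\<rho> (A \<otimes>\<^bsub>?G\<^esub> B) = \<rho> A \<otimes>\<^bsub>SL2C\<^esub> \<rho> B"
        using presented_group_mult[OF u(1) v(1), of R]
        by (simp only: u(2) v(2) val[OF u(1)] val[OF v(1)] val word_val_append)
          (simp add: SL2C_def)
    qed
    moreover have "z = (\<lambda>(i, j, k) \<in> X \<times> UNIV \<times> UNIV. \<rho> (pres_gen X R i) $ j $ k)"
    proof
      fix q :: "'a \<times> 2 \<times> 2"
      obtain i j k where q: "q = (i, j, k)" by (cases q)
      show "z q = (\<lambda>(i, j, k) \<in> X \<times> UNIV \<times> UNIV. \<rho> (pres_gen X R i) $ j $ k) q"
      proof (cases "i \<in> X")
        case True
        then have "\<rho> (pres_gen X R i) = mat_at z i"
          unfolding pres_gen_def by (subst val) simp_all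
        then show ?thesis using True by (simp add: q mat_at_def)
      next
        case False
        then show ?thesis using z by (auto simp: q PiE_def extensional_def)
      qed
    qed
    ultimately show "z \<in> ?V" unfolding rep_variety_def by blast
  qed
qed

definition power_variety :: "nat \<Rightarrow> (nat \<Rightarrow> nat) \<Rightarrow> (nat \<times> 2 \<times> 2 \<Rightarrow> complex) set" where
  "power_variety n p = {z \<in> PiE ({1..n} \<times> UNIV \<times> UNIV) (\<lambda>_. UNIV).
        (\<forall>i\<in>{1..n}. det (mat_at z i) = 1) \<and> pprod (mat_at z) p [1..<Suc n] = mat 1}"

lemma rep_variety_power_word:
  "rep_variety (presented_group {1..n} {power_word n p}) {1..n} (pres_gen {1..n} {power_word n p}) =
     power_variety n p"
proof -
  have "power_word n p \<in> lists ({1..n} \<times> UNIV)"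
    unfolding power_word_def by auto
  then show ?thesis
    unfolding rep_variety_presented_group word_val_power_word[symmetric] power_variety_def by auto
qed

section \<open>The upper bound\<close>

definition tr_at :: "'i \<Rightarrow> ('i \<times> 2 \<times> 2 \<Rightarrow> complex) \<Rightarrow> complex" where
  "tr_at i z = trace (mat_at z i)"

definition diag_diff :: "'i \<Rightarrow> ('i \<times> 2 \<times> 2 \<Rightarrow> complex) \<Rightarrow> complex" where
  "diag_diff i z = z (i, 1, 1) - z (i, 2, 2)"

definition entry :: "'i \<Rightarrow> 2 \<Rightarrow> 2 \<Rightarrow> ('i \<times> 2 \<times> 2 \<Rightarrow> complex) \<Rightarrow> complex" where
  "entry i j k z = z (i, j, k)"

text \<open>Thus the difference of the diagonal entries is integral over the trace and the off-diagonal entries.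
  This makes trace and off-diagonal entries a Noether normalisation of \<open>SL\<^sub>2\<close>.\<close>

lemma diag_diff_square:
  assumes "det (mat_at z i) = 1"
  shows "diag_diff i z ^ 2 = tr_at i z ^ 2 - 4 - 4 * (entry i 1 2 z * entry i 2 1 z)"
proof -
  have "z (i, 1, 1) * z (i, 2, 2) = 1 + z (i, 1, 2) * z (i, 2, 1)"
    using assms by (simp add: det_2 algebra_simps)
  moreover have "diag_diff i z ^ 2 = tr_at i z ^ 2 - 4 * (z (i, 1, 1) * z (i, 2, 2))"
    by (simp add: diag_diff_def tr_at_def trace_2 power2_eq_square algebra_simps)
  ultimately show ?thesis by (simp add: entry_def algebra_simps)
qed

lemma growth_at_most_diag_diff:
  assumes "growth_at_most S F D" "finite J" "\<And>z i. z \<in> S \<Longrightarrow> i \<in> J \<Longrightarrow> det (mat_at z i) = 1"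
    and F: "\<And>i. i \<in> J \<Longrightarrow> tr_at i \<in> F" "\<And>i. i \<in> J \<Longrightarrow> entry i 1 2 \<in> F" "\<And>i. i \<in> J \<Longrightarrow> entry i 2 1 \<in> F"
  shows "growth_at_most S (F \<union> diag_diff ` J) D"
proof (rule growth_at_most_union_integral[OF _ assms(1)])
  fix g assume "g \<in> diag_diff ` J"
  then obtain i where i: "i \<in> J" "g = diag_diff i" by blast
  have "regular_on S F (\<lambda>z. tr_at i z ^ 2 - 4 - 4 * (entry i 1 2 z * entry i 2 1 z))"
    by (intro regular_on_diff regular_on_mult regular_on_power regular_on_const regular_on_gen F i)
  then have "regular_on S F (\<lambda>z. poly (monom 1 2) (g z))"
    by (rule regular_on_cong) (use i assms(3) in \<open>simp add: poly_monom diag_diff_square\<close>)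
  then show "\<exists>q. regular_on S F (\<lambda>x. poly q (g x)) \<and> lead_coeff q = 1 \<and> degree q > 0"
    by (intro exI[of _ "monom 1 2"]) (simp add: degree_monom_eq)
qed (use assms(2) in simp)

lemma regular_on_entry:
  assumes "tr_at i \<in> F" "diag_diff i \<in> F" "entry i 1 2 \<in> F" "entry i 2 1 \<in> F"
  shows "regular_on S F (\<lambda>z. z (i, j, k))"
proof -
  have "(\<lambda>z. z (i, 1, 1)) = (\<lambda>z. 1/2 * (tr_at i z + diag_diff i z))"
    "(\<lambda>z. z (i, 2, 2)) = (\<lambda>z. 1/2 * (tr_at i z - diag_diff i z))"
    "(\<lambda>z. z (i, 1, 2)) = entry i 1 2" "(\<lambda>z. z (i, 2, 1)) = entry i 2 1"
    by (auto simp: tr_at_def diag_diff_def trace_2 entry_def fun_eq_iff)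
  moreover have "regular_on S F (\<lambda>z. 1/2 * (tr_at i z + diag_diff i z))"
    "regular_on S F (\<lambda>z. 1/2 * (tr_at i z - diag_diff i z))"
    by (intro regular_on_mult regular_on_add regular_on_diff regular_on_const regular_on_gen assms)+
  ultimately show ?thesis
    using exhaust_2[of j] exhaust_2[of k] regular_on_gen[OF assms(3)] regular_on_gen[OF assms(4)] by auto
qed

lemma regular_on_matrix_mult:
  fixes A B :: "'a \<Rightarrow> complex^2^2"
  assumes "\<And>i j. regular_on S F (\<lambda>x. A x $ i $ j)" "\<And>i j. regular_on S F (\<lambda>x. B x $ i $ j)"
  shows "regular_on S F (\<lambda>x. (A x ** B x) $ i $ j)"
  unfolding matrix_mult_entry_2 by (intro regular_on_add regular_on_mult assms)

lemma regular_on_pprod: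
  assumes "\<And>x i j. x \<in> set xs \<Longrightarrow> regular_on S F (\<lambda>z. M z x $ i $ j)"
  shows "regular_on S F (\<lambda>z. pprod (M z) p xs $ i $ j)"
  by (rule pprod_entry_closed[where Q = "regular_on S F"]) (auto intro: assms)

lemma regular_on_adj2:
  assumes "\<And>i j. regular_on S F (\<lambda>x. A x $ i $ j)"
  shows "regular_on S F (\<lambda>x. adj2 (A x) $ i $ j)"
  using exhaust_2[of i] exhaust_2[of j]
  by (auto simp: adj2_def intro!: regular_on_uminus assms)

text \<open>The off-diagonal entries are \<open>2 * card J\<close> generators, and all other functions are integral over them:
  the trace \<open>t\<close> satisfies \<open>T\<^sub>p(t)\<^sup>2 = 4\<close>, since \<open>T\<^sub>p(t)\<close> is the trace of \<open>\<plusminus>1\<close>.\<close>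

lemma growth_all_central:
  fixes S :: "('i \<times> 2 \<times> 2 \<Rightarrow> complex) set"
  assumes J: "finite J" and p: "\<And>i. i \<in> J \<Longrightarrow> p i > 0"
    and det: "\<And>z i. z \<in> S \<Longrightarrow> i \<in> J \<Longrightarrow> det (mat_at z i) = 1"
    and central: "\<And>z i. z \<in> S \<Longrightarrow> i \<in> J \<Longrightarrow> mpow (mat_at z i) (p i) \<in> {mat 1, mat (-1)}"
  shows "growth_at_most S ((\<lambda>q z. z q) ` (J \<times> UNIV \<times> UNIV)) (2 * card J)"
proof -
  define F1 :: "(('i \<times> 2 \<times> 2 \<Rightarrow> complex) \<Rightarrow> complex) set"
    where "F1 = (\<lambda>i. entry i 1 2) ` J \<union> (\<lambda>i. entry i 2 1) ` J"
  have "card F1 \<le> card J + card J"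
    unfolding F1_def by (rule order.trans[OF card_Un_le]) (intro add_mono card_image_le J)
  then have "growth_at_most S F1 (2 * card J)"
    using growth_at_most_card[of F1 S] growth_at_most_mono J unfolding F1_def by fastforce
  then have 2: "growth_at_most S (F1 \<union> tr_at ` J) (2 * card J)"
  proof (rule growth_at_most_union_integral[rotated])
    fix g :: "('i \<times> 2 \<times> 2 \<Rightarrow> complex) \<Rightarrow> complex" assume "g \<in> tr_at ` J"
    then obtain i where i: "i \<in> J" "g = tr_at i" by blast
    obtain k where k: "p i = Suc k" using p[OF i(1)] gr0_implies_Suc by blast
    have "poly (chebT (p i) ^ 2) (g z) = 4" if "z \<in> S" for z
    proof -
      have "poly (chebT (p i)) (g z) = trace (mpow (mat_at z i) (p i))"
        using trace_mpow[OF det[OF that i(1)]] by (simp add: i(2) tr_at_def)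
      also have "\<dots> = 2 \<or> \<dots> = - 2" using central[OF that i(1)] by (auto simp: trace_2)
      finally show ?thesis by auto
    qed
    then have "regular_on S F1 (\<lambda>z. poly (chebT (p i) ^ 2) (g z))"
      using regular_on_cong[OF regular_on_const[of S F1 4]] by simp
    moreover have "chebT (p i) \<noteq> 0" unfolding k using chebT_monic[of k] by force
    then have "lead_coeff (chebT (p i) ^ 2) = 1" "degree (chebT (p i) ^ 2) > 0"
      unfolding k lead_coeff_power using chebT_monic[of k] by (auto simp: degree_power_eq)
    ultimately show "\<exists>q. regular_on S F1 (\<lambda>x. poly q (g x)) \<and> lead_coeff q = 1 \<and> degree q > 0"
      by blast
  qed (use J in simp)
  have 3: "growth_at_most S ((F1 \<union> tr_at ` J) \<union> diag_diff ` J) (2 * card J)"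
    by (rule growth_at_most_diag_diff[OF 2 J det]) (auto simp: F1_def)
  show ?thesis
  proof (rule growth_at_most_localise[OF 3, of _ "\<lambda>_. 1"])
    fix f :: "('i \<times> 2 \<times> 2 \<Rightarrow> complex) \<Rightarrow> complex"
    assume "f \<in> (\<lambda>q z. z q) ` (J \<times> UNIV \<times> UNIV)"
    then obtain i j k where f: "i \<in> J" "f = (\<lambda>z. z (i, j, k))" by auto
    show "regular_on S (F1 \<union> tr_at ` J \<union> diag_diff ` J) (\<lambda>x. 1 * f x)"
      unfolding f(2) mult_1 by (rule regular_on_entry) (use f(1) in \<open>auto simp: F1_def\<close>)
  qed (use J in auto)
qed

text \<open>The relation determines \<open>C = A\<^sub>i ^ p i\<close> by the other matrices.  These have \<open>3 (n - 1)\<close> parameters, up to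
  integral elements; the trace of \<open>A\<^sub>i\<close> is a root of the monic polynomial \<open>T\<^sub>p - tr C\<close>; and the
  entries of \<open>A\<^sub>i\<close> itself are obtained from \<open>C = U\<^sub>p(t) A\<^sub>i - U\<^sub>p\<^sub>-\<^sub>1(t)\<close>, where \<open>U\<^sub>p(t)\<close> has no zeros
  by \<open>mpow_scalar\<close>.\<close>

lemma growth_noncentral:
  fixes S :: "(nat \<times> 2 \<times> 2 \<Rightarrow> complex) set"
  assumes i: "i \<in> {1..n}" and p: "p i > 0"
    and det: "\<And>z j. z \<in> S \<Longrightarrow> j \<in> {1..n} \<Longrightarrow> det (mat_at z j) = 1"
    and rel: "\<And>z. z \<in> S \<Longrightarrow> pprod (mat_at z) p [1..<Suc n] = mat 1"
    and noncentral: "\<And>z. z \<in> S \<Longrightarrow> mpow (mat_at z i) (p i) \<notin> {mat 1, mat (-1)}"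
  shows "growth_at_most S ((\<lambda>q z. z q) ` ({1..n} \<times> UNIV \<times> UNIV)) (3 * (n - 1))"
proof -
  define J where "J = {1..n} - {i}"
  have J: "finite J" "card J = n - 1" "J \<subseteq> {1..n}" using i by (auto simp: J_def)
  define F0 :: "((nat \<times> 2 \<times> 2 \<Rightarrow> complex) \<Rightarrow> complex) set"
    where "F0 = tr_at ` J \<union> ((\<lambda>i. entry i 1 2) ` J \<union> (\<lambda>i. entry i 2 1) ` J)"
  have "card F0 \<le> card J + (card J + card J)"
    unfolding F0_def
    by (rule order.trans[OF card_Un_le] add_mono card_image_le J)+
  then have 0: "growth_at_most S F0 (3 * (n - 1))"
    using growth_at_most_card[of F0 S] growth_at_most_mono J unfolding F0_def by fastforce
  define F1 where "F1 = F0 \<union> diag_diff ` J"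
  have 1: "growth_at_most S F1 (3 * (n - 1))"
    unfolding F1_def by (rule growth_at_most_diag_diff[OF 0 J(1)]) (use det J(3) in \<open>auto simp: F0_def\<close>)
  have reg: "regular_on S F1 (\<lambda>z. z (j, k, l))" if "j \<in> J" for j k l
    by (rule regular_on_entry) (use that in \<open>auto simp: F1_def F0_def\<close>)
  obtain m where m: "p i = Suc m" using p gr0_implies_Suc by blast
  define C where "C = (\<lambda>z. adj2 (pprod (mat_at z) p [1..<i]) ** adj2 (pprod (mat_at z) p [Suc i..<Suc n]))"
  have C_reg: "regular_on S F1 (\<lambda>z. C z $ k $ l)" for k l
    unfolding C_def
    by (intro regular_on_matrix_mult regular_on_adj2 regular_on_pprod)
      (use i in \<open>auto simp: J_def intro!: reg\<close>)
  have C: "mpow (mat_at z i) (p i) = C z" if z: "z \<in> S" for z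
  proof -
    let ?P = "pprod (mat_at z) p [1..<i]" and ?Q = "pprod (mat_at z) p [Suc i..<Suc n]"
      and ?A = "mpow (mat_at z i) (p i)"
    have split: "[1..<Suc n] = [1..<i] @ i # [Suc i..<Suc n]"
      using i upt_add_eq_append[of 1 i "Suc n - i"] upt_conv_Cons[of i "Suc n"] by simp
    have "?P ** (?A ** ?Q) = mat 1" using rel[OF z] unfolding split pprod_append pprod_simps .
    moreover have P: "det ?P = 1" and Q: "det ?Q = 1"
      using i by (auto intro!: det_pprod det[OF z])
    ultimately have "?A ** ?Q = adj2 ?P"
      by (metis adj2_inverse(2) matrix_mul_assoc matrix_mul_lid matrix_mul_rid)
    then show ?thesis unfolding C_def
      using adj2_inverse(1)[OF Q] by (metis matrix_mul_assoc matrix_mul_rid)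
  qed
  define F2 where "F2 = insert (tr_at i) F1"
  have 2: "growth_at_most S F2 (3 * (n - 1))"
    unfolding F2_def
  proof (rule growth_at_most_integral[OF 1, of "chebT (p i)"])
    have "regular_on S F1 (\<lambda>z. C z $ 1 $ 1 + C z $ 2 $ 2)" by (intro regular_on_add C_reg)
    then show "regular_on S F1 (\<lambda>z. poly (chebT (p i)) (tr_at i z))"
    proof (rule regular_on_cong)
      fix z assume z: "z \<in> S"
      show "poly (chebT (p i)) (tr_at i z) = C z $ 1 $ 1 + C z $ 2 $ 2"
        using trace_mpow[OF det[OF z i], of "p i"] unfolding C[OF z] tr_at_def trace_2[of "C z"] ..
    qed
  qed (use chebT_monic[of m] in \<open>auto simp: m\<close>)
  have F12: "F1 \<subseteq> F2" unfolding F2_def by blast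
  have tr: "regular_on S F2 (tr_at i)" unfolding F2_def by (rule regular_on_gen) simp
  let ?w = "\<lambda>z. poly (chebU (p i)) (tr_at i z)"
  show ?thesis
  proof (rule growth_at_most_localise[OF 2, of _ ?w])
    show "?w z \<noteq> 0" if "z \<in> S" for z
      using mpow_scalar[OF det[OF that i], of m] noncentral[OF that] unfolding m tr_at_def by auto
    fix f :: "(nat \<times> 2 \<times> 2 \<Rightarrow> complex) \<Rightarrow> complex"
    assume "f \<in> (\<lambda>q z. z q) ` ({1..n} \<times> UNIV \<times> UNIV)"
    then obtain j k l where f: "j \<in> {1..n}" "f = (\<lambda>z. z (j, k, l))" by auto
    show "regular_on S F2 (\<lambda>z. ?w z * f z)"
    proof (cases "j = i")
      case True
      have "regular_on S F2 (\<lambda>z. C z $ k $ l + poly (chebU m) (tr_at i z) * mat 1 $ k $ l)"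
        by (intro regular_on_add regular_on_mult regular_on_poly tr regular_on_const
            regular_on_subset[OF C_reg F12])
      then show ?thesis
      proof (rule regular_on_cong)
        fix z assume z: "z \<in> S"
        show "?w z * f z = C z $ k $ l + poly (chebU m) (tr_at i z) * mat 1 $ k $ l"
          unfolding C[OF z, symmetric] m mpow_chebU[OF det[OF z i]] f(2) True tr_at_def by simp
      qed
    next
      case False
      then have "j \<in> J" using f(1) by (simp add: J_def)
      then show ?thesis unfolding f(2)
        by (intro regular_on_mult regular_on_poly tr regular_on_subset[OF reg F12])
    qed
  qed (auto intro: regular_on_poly tr)
qed

text \<open>The piece with all powers equal to \<open>\<plusminus>1\<close> has dimension at most \<open>2 n\<close>, which exceeds \<open>3 (n - 1)\<close> for
  \<open>n = 2\<close>; this is where \<open>n \<ge> 3\<close> enters.\<close>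

lemma affine_dim_of_power_variety_le:
  fixes n :: nat and p :: "nat \<Rightarrow> nat"
  assumes n: "n \<ge> 3" and p: "\<And>i. i \<in> {1..n} \<Longrightarrow> p i > 0"
  shows "affine_dim_of ({1..n} \<times> UNIV \<times> UNIV) (power_variety n p) \<le> enat (3 * (n - 1))"
proof (rule affine_dim_of_le)
  let ?V = "power_variety n p"
  let ?I = "{1..n} \<times> (UNIV :: 2 set) \<times> (UNIV :: 2 set)"
  let ?F = "(\<lambda>q (z :: nat \<times> 2 \<times> 2 \<Rightarrow> complex). z q) ` ?I"
  let ?Z = "{mat 1, mat (-1)} :: (complex^2^2) set"
  show "?V \<subseteq> PiE ?I (\<lambda>_. UNIV)" unfolding power_variety_def by auto
  let ?C = "{z \<in> ?V. \<forall>i\<in>{1..n}. mpow (mat_at z i) (p i) \<in> ?Z}"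
    and ?N = "\<lambda>i. {z \<in> ?V. mpow (mat_at z i) (p i) \<notin> ?Z}"
  have "growth_at_most ?C ?F (2 * card {1..n})"
    by (rule growth_all_central[where p = p]) (use p in \<open>auto simp: power_variety_def\<close>)
  then have "growth_at_most ?C ?F (3 * (n - 1))"
    by (rule growth_at_most_mono) (use n in simp)
  moreover have "growth_at_most (\<Union>i\<in>{1..n}. ?N i) ?F (3 * (n - 1))"
  proof (rule growth_at_most_UN)
    fix i assume i: "i \<in> {1..n}"
    show "growth_at_most (?N i) ?F (3 * (n - 1))"
      by (rule growth_noncentral[where p = p, OF i p[OF i]]) (auto simp: power_variety_def)
  qed (use n in auto)
  ultimately have "growth_at_most (?C \<union> (\<Union>i\<in>{1..n}. ?N i)) ?F (3 * (n - 1))"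
    by (rule growth_at_most_Un)
  then have growth: "growth_at_most ?V ?F (3 * (n - 1))"
    by (rule growth_at_most_anti) blast
  fix f assume f: "\<And>i. i \<le> 3 * (n - 1) \<Longrightarrow> complex_poly_fun ?I (f i)"
  show "\<not> alg_indep_on ?V (Suc (3 * (n - 1))) f"
  proof (rule growth_at_most_dependent[OF growth])
    fix i assume "i \<le> 3 * (n - 1)"
    then have "complex_poly_fun ?I (f i)" by (rule f)
    then have "regular_on ?V ?F (\<lambda>x. f i (\<lambda>q. x q))"
      by (rule regular_on_complex_poly_fun) (auto intro: regular_on_gen)
    then show "regular_on ?V ?F (f i)" by simp
  qed
qed

section \<open>The lower bound\<close>

lemma poly_chebT_chebU_eigenvalue:
  fixes l m :: complex
  assumes "l * m = 1"
  shows "poly (chebT k) (l + m) = l ^ k + m ^ k" "poly (chebU k) (l + m) * (l - m) = l ^ k - m ^ k"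
proof -
  have lm: "l * (m * c) = c" "m * (l * c) = c" for c
    using assms by (metis mult.assoc mult.commute mult_1)+
  show "poly (chebT k) (l + m) = l ^ k + m ^ k"
  proof (induction k rule: chebT.induct)
    case (3 k)
    then show ?case by (simp add: ring_distribs lm)
  qed auto
  show "poly (chebU k) (l + m) * (l - m) = l ^ k - m ^ k"
  proof (induction k rule: chebU.induct)
    case (3 k)
    have "poly (chebU (Suc (Suc k))) (l + m) * (l - m) =
        (l + m) * (poly (chebU (Suc k)) (l + m) * (l - m)) - poly (chebU k) (l + m) * (l - m)"
      by (simp add: algebra_simps)
    then show ?case unfolding 3 by (simp add: ring_distribs lm)
  qed auto
qed

text \<open>The trace \<open>l + 1/l\<close> of a \<open>q\<close>-th root of a matrix of trace \<open>t\<close> and determinant \<open>1\<close>: the argument of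
  the logarithm is an eigenvalue \<open>s\<close> of the matrix, and \<open>l\<close> is a \<open>q\<close>-th root of \<open>s\<close>.\<close>

definition root_trace :: "nat \<Rightarrow> complex \<Rightarrow> complex" where
  "root_trace q t = (let l = exp (Ln ((t + csqrt (t\<^sup>2 - 4)) / 2) / of_nat q) in l + inverse l)"

text \<open>The region \<open>Re t > 2\<close> avoids the branch cuts of the square root and of the logarithm.\<close>

lemma csqrt_domain:
  assumes "Re t > 2"
  shows "t\<^sup>2 - 4 \<notin> \<real>\<^sub>\<le>\<^sub>0" "(t + csqrt (t\<^sup>2 - 4)) / 2 \<notin> \<real>\<^sub>\<le>\<^sub>0"
proof -
  show "t\<^sup>2 - 4 \<notin> \<real>\<^sub>\<le>\<^sub>0"
  proof
    assume "t\<^sup>2 - 4 \<in> \<real>\<^sub>\<le>\<^sub>0"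
    then have "Re t * Im t = 0" "Re t * Re t - Im t * Im t \<le> 4"
      by (auto simp: complex_nonpos_Reals_iff power2_eq_square)
    moreover have "2 * 2 < Re t * Re t" using assms by (intro mult_strict_mono) auto
    ultimately show False using assms by auto
  qed
  have "Re ((t + csqrt (t\<^sup>2 - 4)) / 2) > 0"
    using assms Re_csqrt[of "t\<^sup>2 - 4"] by (simp del: csqrt.simps)
  then show "(t + csqrt (t\<^sup>2 - 4)) / 2 \<notin> \<real>\<^sub>\<le>\<^sub>0"
    by (auto simp: complex_nonpos_Reals_iff)
qed

lemma root_trace_holomorphic: "root_trace q holomorphic_on {t. Re t > 2}"
  unfolding root_trace_def Let_def
  by (intro holomorphic_intros) (use csqrt_domain in auto)

lemma root_trace:
  assumes t: "Re t > 2" and q: "q > 0"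
  shows "poly (chebT q) (root_trace q t) = t" "poly (chebU q) (root_trace q t) \<noteq> 0"
proof -
  define r where "r = csqrt (t\<^sup>2 - 4)"
  define s where "s = (t + r) / 2"
  define l where "l = exp (Ln s / of_nat q)"
  have r2: "r\<^sup>2 = t\<^sup>2 - 4" by (simp add: r_def)
  have s_inv: "s * ((t - r) / 2) = 1"
    using r2 by (simp add: s_def power2_eq_square algebra_simps)
  then have s0: "s \<noteq> 0" by auto
  then have inv_s: "inverse s = (t - r) / 2" using s_inv by (simp add: field_simps)
  have l0: "l * inverse l = 1" by (simp add: l_def)
  have lq: "l ^ q = s" using q s0 by (simp add: l_def exp_of_nat_mult[symmetric])
  have rt: "root_trace q t = l + inverse l"
    by (simp add: root_trace_def Let_def l_def s_def r_def)
  have "poly (chebT q) (root_trace q t) = s + inverse s"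
    using poly_chebT_chebU_eigenvalue(1)[OF l0, of q] lq by (simp add: rt power_inverse)
  also have "\<dots> = t" unfolding inv_s by (simp add: s_def field_simps)
  finally show "poly (chebT q) (root_trace q t) = t" .
  have "r \<noteq> 0"
  proof
    assume "r = 0"
    then have "t\<^sup>2 - 4 \<in> \<real>\<^sub>\<le>\<^sub>0" using r2 by simp
    then show False using csqrt_domain(1)[OF t] by simp
  qed
  moreover have "s - inverse s = r" unfolding inv_s by (simp add: s_def field_simps)
  ultimately show "poly (chebU q) (root_trace q t) \<noteq> 0"
    using poly_chebT_chebU_eigenvalue(2)[OF l0, of q] lq by (auto simp: rt power_inverse)
qed

text \<open>The product of the elementary matrices with rows \<open>(1, a), (0, 1)\<close>, then \<open>(1, 0), (b, 1)\<close>, then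
  \<open>(1, c), (0, 1)\<close>.  The matrix with index \<open>k \<ge> 1\<close> uses the three parameters starting at
  \<open>3 (k - 1)\<close>.\<close>

definition par_mat :: "(nat \<Rightarrow> complex) \<Rightarrow> nat \<Rightarrow> complex^2^2" where
  "par_mat x k = (let a = x (3 * (k - 1)); b = x (3 * (k - 1) + 1); c = x (3 * (k - 1) + 2)
     in mat2 (1 + a * b) (c * (1 + a * b) + a) b (b * c + 1))"

lemma par_mat_entries [simp]:
  "par_mat x k $ 1 $ 1 = 1 + x (3 * (k - 1)) * x (3 * (k - 1) + 1)"
  "par_mat x k $ 1 $ 2 = x (3 * (k - 1) + 2) * (1 + x (3 * (k - 1)) * x (3 * (k - 1) + 1)) + x (3 * (k - 1))"
  "par_mat x k $ 2 $ 1 = x (3 * (k - 1) + 1)"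
  "par_mat x k $ 2 $ 2 = x (3 * (k - 1) + 1) * x (3 * (k - 1) + 2) + 1"
  by (simp_all add: par_mat_def Let_def)

lemma det_par_mat [simp]: "det (par_mat x k) = 1"
  by (simp add: det_2 algebra_simps)

definition par_prod :: "nat \<Rightarrow> (nat \<Rightarrow> nat) \<Rightarrow> (nat \<Rightarrow> complex) \<Rightarrow> complex^2^2" where
  "par_prod n p x = pprod (par_mat x) p [1..<n]"

lemma det_par_prod [simp]: "det (par_prod n p x) = 1"
  by (simp add: par_prod_def det_pprod)

text \<open>The matrix from \<open>mpow_root\<close> for the trace chosen by \<open>root_trace\<close>.\<close>

definition par_root :: "nat \<Rightarrow> (nat \<Rightarrow> nat) \<Rightarrow> (nat \<Rightarrow> complex) \<Rightarrow> complex^2^2" where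
  "par_root n p x = (let B = par_prod n p x; t = root_trace (p n) (trace B) in
     \<chi> i j. (B $ i $ j + poly (chebU (p n - 1)) t * mat 1 $ i $ j) / poly (chebU (p n)) t)"

lemma par_root:
  assumes "Re (trace (par_prod n p x)) > 2" "p n > 0"
  shows "det (par_root n p x) = 1" "mpow (par_root n p x) (p n) = par_prod n p x"
proof -
  obtain m where m: "p n = Suc m" using assms(2) gr0_implies_Suc by blast
  note r = root_trace[OF assms, unfolded m]
  show "det (par_root n p x) = 1" "mpow (par_root n p x) (p n) = par_prod n p x"
    using mpow_root[OF det_par_prod r] unfolding par_root_def Let_def m by simp_all
qed

definition par_point :: "nat \<Rightarrow> (nat \<Rightarrow> nat) \<Rightarrow> (nat \<Rightarrow> complex) \<Rightarrow> (nat \<times> 2 \<times> 2 \<Rightarrow> complex)" where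
  "par_point n p x = (\<lambda>(i, j, k) \<in> {1..n} \<times> UNIV \<times> UNIV.
     (if i < n then par_mat x i else adj2 (par_root n p x)) $ j $ k)"

lemma mat_at_par_point:
  "i \<in> {1..n} \<Longrightarrow> mat_at (par_point n p x) i = (if i < n then par_mat x i else adj2 (par_root n p x))"
  by (simp add: par_point_def vec_eq_iff mat_at_def)

lemma par_point_in_variety:
  assumes "Re (trace (par_prod n p x)) > 2" "p n > 0" "n > 0"
  shows "par_point n p x \<in> power_variety n p"
proof -
  let ?z = "par_point n p x"
  have "det (mat_at ?z i) = 1" if "i \<in> {1..n}" for i
    using par_root(1)[of n p x] assms by (simp add: mat_at_par_point[OF that])
  moreover have "pprod (mat_at ?z) p [1..<Suc n] = mat 1"
  proof -
    have "pprod (mat_at ?z) p [1..<n] = par_prod n p x"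
      unfolding par_prod_def by (rule pprod_cong) (auto simp: mat_at_par_point)
    moreover have "mpow (mat_at ?z n) (p n) = adj2 (par_prod n p x)"
      using assms(3) par_root(2)[OF assms(1,2)] by (simp add: mat_at_par_point mpow_adj2)
    moreover have "[1..<Suc n] = [1..<n] @ [n]" using assms(3) by simp
    ultimately show ?thesis
      by (simp add: pprod_append adj2_inverse del: upt_Suc)
  qed
  moreover have "?z \<in> PiE ({1..n} \<times> UNIV \<times> UNIV) (\<lambda>_. UNIV)" unfolding par_point_def by auto
  ultimately show ?thesis unfolding power_variety_def by blast
qed

lemma par_prod_entry_closed:
  fixes Q :: "('a \<Rightarrow> complex) \<Rightarrow> bool"
  assumes const: "\<And>c. Q (\<lambda>_. c)"
    and add: "\<And>f g. Q f \<Longrightarrow> Q g \<Longrightarrow> Q (\<lambda>z. f z + g z)"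
    and mult: "\<And>f g. Q f \<Longrightarrow> Q g \<Longrightarrow> Q (\<lambda>z. f z * g z)"
    and X: "\<And>m. Q (\<lambda>z. X z m)"
  shows "Q (\<lambda>z. par_mat (X z) k $ i $ j)" "Q (\<lambda>z. par_prod n p (X z) $ i $ j)"
proof -
  have *: "Q (\<lambda>z. par_mat (X z) k $ i $ j)" for k i j
    using exhaust_2[of i] exhaust_2[of j] by (auto intro!: add mult X const)
  show "Q (\<lambda>z. par_mat (X z) k $ i $ j)" by (rule *)
  show "Q (\<lambda>z. par_prod n p (X z) $ i $ j)" unfolding par_prod_def
    by (rule pprod_entry_closed[where Q = Q, OF const add mult *])
qed

lemma holomorphic_on_poly_fun: "f holomorphic_on S \<Longrightarrow> (\<lambda>z. poly q (f z)) holomorphic_on S"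
  by (induction q) (auto intro!: holomorphic_intros)

lemma par_point_holomorphic:
  assumes X: "\<And>m. (\<lambda>z. X z m) holomorphic_on T"
    and T: "\<And>z. z \<in> T \<Longrightarrow> Re (trace (par_prod n p (X z))) > 2" and pn: "p n > 0"
    and q: "q \<in> {1..n} \<times> UNIV \<times> UNIV"
  shows "(\<lambda>z. par_point n p (X z) q) holomorphic_on T"
proof -
  note closed = par_prod_entry_closed[where Q = "\<lambda>f. f holomorphic_on T", OF holomorphic_on_const
      holomorphic_on_add holomorphic_on_mult X]
  have "(\<lambda>z. trace (par_prod n p (X z))) holomorphic_on T"
    unfolding trace_2 by (intro holomorphic_on_add closed)
  then have rt: "(\<lambda>z. root_trace (p n) (trace (par_prod n p (X z)))) holomorphic_on T"
    using holomorphic_on_compose_gen[OF _ root_trace_holomorphic, of _ T "p n"] T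
    by (force simp: o_def)
  have root: "(\<lambda>z. par_root n p (X z) $ i $ j) holomorphic_on T" for i j
    unfolding par_root_def Let_def vec_lambda_beta
    by (intro holomorphic_on_divide holomorphic_on_add holomorphic_on_mult closed
        holomorphic_on_poly_fun rt holomorphic_on_const) (use root_trace(2) T pn in auto)
  obtain i j k where q': "q = (i, j, k)" "i \<in> {1..n}" using q by auto
  have "(\<lambda>z. par_point n p (X z) q) =
      (\<lambda>z. (if i < n then par_mat (X z) i else adj2 (par_root n p (X z))) $ j $ k)"
    unfolding q'(1) mat_at_par_point[OF q'(2), symmetric] by simp
  moreover have "\<dots> holomorphic_on T"
    using exhaust_2[of j] exhaust_2[of k]
    by (cases "i < n") (auto simp: adj2_def simp del: par_mat_entries
        intro!: closed root holomorphic_on_minus)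
  ultimately show ?thesis by simp
qed

lemma complex_poly_fun_holomorphic:
  assumes "complex_poly_fun I f" "\<And>q. q \<in> I \<Longrightarrow> (\<lambda>z. g z q) holomorphic_on T"
  shows "(\<lambda>z. f (g z)) holomorphic_on T"
  using assms by induction (auto intro: holomorphic_intros)

text \<open>If \<open>f\<close> is not zero at \<open>u\<close>, it is not zero near \<open>u\<close>, so \<open>g\<close> vanishes there, and hence everywhere by
  the identity theorem.\<close>

lemma holomorphic_no_zero_divisors:
  assumes "open T" "connected T" "f holomorphic_on T" "g holomorphic_on T"
    and prod: "\<And>z. z \<in> T \<Longrightarrow> f z * g z = 0" and "u \<in> T" "f u \<noteq> 0" "v \<in> T"
  shows "g v = 0"
proof -
  let ?U = "T \<inter> f -` (- {0})"
  have "open ?U"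
    using holomorphic_on_imp_continuous_on[OF assms(3)] assms(1)
    by (intro continuous_open_preimage) auto
  moreover have "?U \<noteq> {}" using assms by auto
  ultimately show ?thesis
    using analytic_continuation_open[of ?U T g "\<lambda>_. 0" v] assms by auto
qed

text \<open>Suppose that \<open>a\<close> is not zero at the image of \<open>x\<close> and \<open>b\<close> not at the image of \<open>y\<close>.  On the complex line
  through \<open>x\<close> and \<open>y\<close> both become holomorphic functions of one variable on a connected domain, and so
  their product is not zero.\<close>

lemma integral_set_par_point:
  fixes D :: "nat \<Rightarrow> complex set" and x0 :: "nat \<Rightarrow> complex"
  assumes D: "\<And>i. open (D i)" "\<And>i. convex (D i)" "\<And>i. x0 i \<in> D i"
    and big: "\<And>x. (\<And>i. x i \<in> D i) \<Longrightarrow> Re (trace (par_prod n p x)) > 2" and pn: "p n > 0"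
  shows "integral_set ({1..n} \<times> UNIV \<times> UNIV)
    (par_point n p ` {x. (\<forall>i. x i \<in> D i) \<and> (\<forall>i\<ge>j. x i = x0 i)})"
    (is "integral_set ?I (_ ` ?X)")
  unfolding integral_set_def
proof (intro conjI allI impI)
  have "x0 \<in> ?X" using D(3) by auto
  then show "par_point n p ` ?X \<noteq> {}" by blast
  fix a b
  assume ab: "complex_poly_fun ?I a \<and> complex_poly_fun ?I b \<and> (\<forall>z\<in>par_point n p ` ?X. a z * b z = 0)"
  show "(\<forall>z\<in>par_point n p ` ?X. a z = 0) \<or> (\<forall>z\<in>par_point n p ` ?X. b z = 0)"
  proof (rule ccontr)
    assume "\<not> ?thesis"
    then obtain x y where x: "x \<in> ?X" "a (par_point n p x) \<noteq> 0" and y: "y \<in> ?X" "b (par_point n p y) \<noteq> 0"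
      by blast
    define L where "L = (\<lambda>t i. x i + t * (y i - x i))"
    define T where "T = {t. \<forall>i. L t i \<in> D i}"
    have L_hol: "(\<lambda>t. L t i) holomorphic_on T" for i
      unfolding L_def by (intro holomorphic_intros)
    have L_const: "L t i = x0 i" if "i \<ge> j" for t i using x(1) y(1) that by (simp add: L_def)
    have T_eq: "T = (\<Inter>i<j. (\<lambda>t. L t i) -` D i)"
      unfolding T_def using L_const D(3) by (force simp: not_less[symmetric])
    have "open T" unfolding T_eq L_def
      by (intro open_INT ballI open_vimage D(1) continuous_intros) auto
    have "convex T"
      unfolding T_eq
    proof (rule convex_INT)
      fix i
      show "convex ((\<lambda>t. L t i) -` D i)"
      proof (rule convexI)
        fix s t :: complex and u v :: real
        assume st: "s \<in> (\<lambda>t. L t i) -` D i" "t \<in> (\<lambda>t. L t i) -` D i" and uv: "0 \<le> u" "0 \<le> v" "u + v = 1"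
        \<comment> \<open>Affine dependence on the line parameter; the weights \<open>u\<close> and \<open>v\<close> add up to \<open>1\<close>.\<close>
        have "L (u *\<^sub>R s + v *\<^sub>R t) i = of_real (u + v) * x i + (u *\<^sub>R s + v *\<^sub>R t) * (y i - x i)"
          by (simp add: L_def uv(3))
        also have "\<dots> = u *\<^sub>R L s i + v *\<^sub>R L t i"
          by (simp add: L_def scaleR_conv_of_real algebra_simps)
        finally show "u *\<^sub>R s + v *\<^sub>R t \<in> (\<lambda>t. L t i) -` D i"
          using convexD[OF D(2)[of i], of "L s i" "L t i" u v] st uv by simp
      qed
    qed
    have coord: "(\<lambda>t. par_point n p (L t) q) holomorphic_on T" if "q \<in> ?I" for q
      by (rule par_point_holomorphic[where X = L and p = p]) (use L_hol big pn that in \<open>auto simp: T_def\<close>)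
    have hol: "(\<lambda>t. c (par_point n p (L t))) holomorphic_on T" if "complex_poly_fun ?I c" for c
      by (rule complex_poly_fun_holomorphic[where g = "\<lambda>t. par_point n p (L t)", OF that coord])
    have prod: "a (par_point n p (L t)) * b (par_point n p (L t)) = 0" if "t \<in> T" for t
    proof -
      have "L t \<in> ?X" using that L_const by (simp add: T_def)
      then show ?thesis using ab by blast
    qed
    have L01: "L 0 = x" "L 1 = y" by (auto simp: L_def)
    then have T01: "0 \<in> T" "1 \<in> T" using x(1) y(1) by (auto simp: T_def)
    have "b (par_point n p (L 1)) = 0"
      by (rule holomorphic_no_zero_divisors[OF \<open>open T\<close> convex_connected[OF \<open>convex T\<close>]
            hol[of a] hol[of b] prod T01(1) _ T01(2)])
        (use ab x(2) L01(1) in simp_all)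
    then show False using y(2) L01 by simp
  qed
qed

text \<open>The parameter point with all coordinates \<open>1\<close> serves as the centre of the polydisc; there each matrix
  of the product has the rows \<open>(2, 3)\<close> and \<open>(1, 2)\<close>.  Positivity of the entries keeps the trace of
  every nontrivial power at \<open>4\<close> or above.\<close>

lemma mpow_positive:
  "\<exists>a b c d :: real. mpow (mat2 2 3 1 2) k = mat2 (of_real a) (of_real b) (of_real c) (of_real d) \<and>
    a \<ge> 1 \<and> b \<ge> 0 \<and> c \<ge> 0 \<and> d \<ge> 1 \<and> (k > 0 \<longrightarrow> a \<ge> 2 \<and> d \<ge> 2)"
proof (induction k)
  case 0
  show ?case by (intro exI[of _ 1] exI[of _ 0]) (auto simp: matrix_eq_2)
next
  case (Suc k)
  then obtain a b c d :: real
    where *: "mpow (mat2 2 3 1 2) k = mat2 (of_real a) (of_real b) (of_real c) (of_real d)"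
      "a \<ge> 1" "b \<ge> 0" "c \<ge> 0" "d \<ge> 1" by blast
  show ?case
    by (rule exI[of _ "2 * a + 3 * c"], rule exI[of _ "2 * b + 3 * d"],
        rule exI[of _ "a + 2 * c"], rule exI[of _ "b + 2 * d"])
      (use *(2-5) in \<open>auto simp: matrix_eq_2 matrix_mult_entry_2 *(1)\<close>)
qed

lemma mpow_add: "mpow A (j + k) = mpow A j ** mpow A k"
  by (induction j) (simp_all add: matrix_mul_assoc)

lemma pprod_const: "pprod (\<lambda>_. A) p xs = mpow A (sum_list (map p xs))"
  by (induction xs) (simp_all add: mpow_add)

lemma trace_par_prod_one:
  assumes "n \<ge> 2" "p 1 > 0"
  shows "Re (trace (par_prod n p (\<lambda>_. 1))) > 2"
proof -
  have "par_mat (\<lambda>_. 1) = (\<lambda>_. mat2 2 3 1 2)"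
    by (rule ext) (simp add: matrix_eq_2)
  then have "par_prod n p (\<lambda>_. 1) = mpow (mat2 2 3 1 2) (sum_list (map p [1..<n]))"
    unfolding par_prod_def by (simp only: pprod_const)
  moreover have "sum_list (map p [1..<n]) > 0"
    using assms upt_conv_Cons[of 1 n] by simp
  ultimately obtain a b c d :: real
    where "par_prod n p (\<lambda>_. 1) = mat2 (of_real a) (of_real b) (of_real c) (of_real d)" "a \<ge> 2" "d \<ge> 2"
    using mpow_positive[of "sum_list (map p [1..<n])"] by auto
  then show ?thesis by (simp add: trace_2)
qed

lemma parameter_polydisc:
  assumes "n \<ge> 2" "p 1 > 0"
  shows "\<exists>\<epsilon>. (\<forall>i. \<epsilon> i > 0) \<and>
    (\<forall>x. (\<forall>i. x i \<in> ball 1 (\<epsilon> i)) \<longrightarrow> Re (trace (par_prod n p x)) > 2)"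
proof -
  let ?S = "{x :: nat \<Rightarrow> complex. 2 < Re (trace (par_prod n p x))}"
  have "continuous_on UNIV (\<lambda>x. par_prod n p x $ i $ j)" for i j
    by (rule par_prod_entry_closed(2)[where Q = "continuous_on UNIV" and X = "\<lambda>x. x"])
      (auto intro: continuous_intros)
  then have "continuous_on UNIV (\<lambda>x. Re (trace (par_prod n p x)))"
    unfolding trace_2 by (intro continuous_on_Re continuous_on_add)
  then have "open ?S" by (intro open_Collect_less continuous_on_const)
  moreover have "(\<lambda>_. 1) \<in> ?S" using trace_par_prod_one[of n p, OF assms] by simp
  ultimately obtain X where X: "(\<lambda>_. 1) \<in> (\<Pi>\<^sub>E i\<in>UNIV. X i)" "\<And>i. open (X i)"
    "(\<Pi>\<^sub>E i\<in>UNIV. X i) \<subseteq> ?S"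
    unfolding open_fun_def using product_topology_open_contains_basis[of "\<lambda>_. euclidean" UNIV ?S "\<lambda>_. 1"]
    by auto
  have "\<exists>e>0. ball 1 e \<subseteq> X i" for i
    using X(1) X(2)[of i] open_contains_ball[of "X i"] by auto
  then obtain \<epsilon> where \<epsilon>: "\<And>i. \<epsilon> i > 0" "\<And>i. ball 1 (\<epsilon> i) \<subseteq> X i" by metis
  then have "x \<in> ?S" if "\<forall>i. x i \<in> ball 1 (\<epsilon> i)" for x
    using that X(3) by (fastforce simp: PiE_def)
  then show ?thesis using \<epsilon>(1) by blast
qed

text \<open>In terms of \<open>a\<close>, \<open>b\<close>, \<open>c\<close> the separating functions are \<open>(a - 1) b\<close>, \<open>b - 1\<close> and \<open>b (c - 1)\<close>, all of
  which are polynomials in the entries of the matrix.  The factor \<open>b\<close> is harmless, since \<open>b = 1\<close> when only \<open>a\<close>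
  or \<open>c\<close> is moved away from \<open>1\<close>.\<close>

lemma parameter_separation:
  assumes j: "j < 3 * (n - 1)"
  shows "\<exists>g. complex_poly_fun ({1..n} \<times> UNIV \<times> UNIV) g \<and>
    (\<forall>x. x j = 1 \<longrightarrow> g (par_point n p x) = 0) \<and>
    (\<forall>e. e \<noteq> 0 \<longrightarrow> g (par_point n p ((\<lambda>_. 1)(j := 1 + e))) \<noteq> 0)"
proof -
  let ?I = "{1..n} \<times> (UNIV :: 2 set) \<times> (UNIV :: 2 set)"
  define i where "i = j div 3"
  let ?k = "Suc i"
  have k: "?k \<in> {1..n}" "?k < n" using j by (auto simp: i_def)
  have entry: "par_point n p x (?k, r, s) = par_mat x ?k $ r $ s" for x r s
    unfolding mat_at_entries[symmetric] mat_at_par_point[OF k(1)] using k(2) by simp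
  have coord: "complex_poly_fun ?I (\<lambda>z. z (?k, r, s))" for r s
    by (rule complex_poly_fun.coord) (use k(1) in simp)
  consider "j = 3 * i" | "j = 3 * i + 1" | "j = 3 * i + 2" unfolding i_def by linarith
  then show ?thesis
  proof cases
    case 1
    have "complex_poly_fun ?I (\<lambda>z. z (?k, 1, 1) - 1 - z (?k, 2, 1))"
      by (intro complex_poly_fun_minus coord complex_poly_fun.const)
    then show ?thesis
      by (intro exI[of _ "\<lambda>z. z (?k, 1, 1) - 1 - z (?k, 2, 1)"])
        (use 1 in \<open>auto simp: entry\<close>)
  next
    case 2
    have "complex_poly_fun ?I (\<lambda>z. z (?k, 2, 1) - 1)"
      by (intro complex_poly_fun_minus coord complex_poly_fun.const)
    then show ?thesis
      by (intro exI[of _ "\<lambda>z. z (?k, 2, 1) - 1"]) (use 2 in \<open>auto simp: entry\<close>)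
  next
    case 3
    have "complex_poly_fun ?I (\<lambda>z. z (?k, 2, 2) - 1 - z (?k, 2, 1))"
      by (intro complex_poly_fun_minus coord complex_poly_fun.const)
    then show ?thesis
      by (intro exI[of _ "\<lambda>z. z (?k, 2, 2) - 1 - z (?k, 2, 1)"])
        (use 3 in \<open>auto simp: entry\<close>)
  qed
qed

lemma affine_dim_of_power_variety_ge:
  fixes n :: nat and p :: "nat \<Rightarrow> nat"
  assumes n: "n \<ge> 2" and p: "\<And>i. i \<in> {1..n} \<Longrightarrow> p i > 0"
  shows "enat (3 * (n - 1)) \<le> affine_dim_of ({1..n} \<times> UNIV \<times> UNIV) (power_variety n p)"
proof -
  let ?V = "power_variety n p"
  have pn: "p n > 0" "p 1 > 0" using p n by auto
  obtain \<epsilon> where \<epsilon>: "\<And>i. \<epsilon> i > 0"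
    and big: "\<And>x. (\<And>i. x i \<in> ball 1 (\<epsilon> i)) \<Longrightarrow> Re (trace (par_prod n p x)) > 2"
    using parameter_polydisc[of n p, OF n pn(2)] by blast
  \<comment> \<open>The coordinate slices of the polydisc, with the parameters from \<open>j\<close> on fixed to \<open>1\<close>.\<close>
  define M where "M = (\<lambda>j. par_point n p ` {x. (\<forall>i. x i \<in> ball 1 (\<epsilon> i)) \<and> (\<forall>i\<ge>j. x i = 1)})"
  show ?thesis
  proof (rule affine_dim_of_ge[where M = M])
    show "?V \<subseteq> PiE ({1..n} \<times> UNIV \<times> UNIV) (\<lambda>_. UNIV)" unfolding power_variety_def by auto
    show "M j \<subseteq> ?V" for j
      unfolding M_def using par_point_in_variety[of n p] big pn(1) n by force
    show "integral_set ({1..n} \<times> UNIV \<times> UNIV) (M j)" for j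
      unfolding M_def
      by (rule integral_set_par_point[where D = "\<lambda>i. ball 1 (\<epsilon> i)" and ?x0.0 = "\<lambda>_. 1"])
        (use \<epsilon> big pn(1) in auto)
    show "M j \<subseteq> M (Suc j)" for j unfolding M_def by (intro image_mono) auto
    fix j assume j: "j < 3 * (n - 1)"
    obtain g where g: "complex_poly_fun ({1..n} \<times> UNIV \<times> UNIV) g"
      "\<And>x. x j = 1 \<Longrightarrow> g (par_point n p x) = 0"
      "\<And>e. e \<noteq> 0 \<Longrightarrow> g (par_point n p ((\<lambda>_. 1)(j := 1 + e))) \<noteq> 0"
      using parameter_separation[OF j, of p] by blast
    let ?x = "(\<lambda>_. 1)(j := 1 + of_real (\<epsilon> j / 2)) :: nat \<Rightarrow> complex"
    have "\<forall>y\<in>M j. g y = 0" unfolding M_def using g(2) by auto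
    moreover have "par_point n p ?x \<in> M (Suc j)"
      unfolding M_def using \<epsilon> abs_of_pos[OF \<epsilon>[of j]] by (intro imageI) (auto simp: dist_norm)
    moreover have "g (par_point n p ?x) \<noteq> 0" using \<epsilon>[of j] by (intro g(3)) simp
    ultimately show "\<exists>g z. complex_poly_fun ({1..n} \<times> UNIV \<times> UNIV) g \<and> (\<forall>y\<in>M j. g y = 0) \<and>
        z \<in> M (Suc j) \<and> g z \<noteq> 0" using g(1) by blast
  qed
qed

section \<open>The dimension\<close>

theorem theorem1p2:
  fixes n :: nat and p :: "nat \<Rightarrow> nat"
  assumes "n \<ge> 3" and "\<forall>i\<in>{1..n}. p i \<ge> 2"
  shows "rep_variety_dim (presented_group {1..n} {power_word n p}) {1..n}
           (pres_gen {1..n} {power_word n p}) = enat (3 * (n - 1))"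
proof -
  have p: "p i > 0" if "i \<in> {1..n}" for i using assms(2) that by fastforce
  show ?thesis
    unfolding rep_variety_dim_def rep_variety_power_word
    using affine_dim_of_power_variety_le[OF assms(1), of p]
      affine_dim_of_power_variety_ge[of n p] assms(1) p
    by (intro antisym) auto
qed

end
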